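(* (Rectangular-matrix setting.) Let $q=\min\{d_1,d_2\}$, $1\le r\le q$, and suppose $\mathcal R(X)=\rho(\boldsymbol\sigma(X))$ for $X\in\mathbb R^{d_1\times d_2}$, where $\rho:\mathbb R_+^q\to\mathbb R\cup\{+\infty\}$ is permutation invariant. Fix $Y\in\mathbb R^{d_1\times d_2}$ and $\lambda>0$, and let $Y=U\,\mathrm{Diag}(\boldsymbol\sigma)V^\top$, $\sigma_1\ge\dots\ge\sigma_q\ge 0$, be a singular value decomposition, where $U$ and $V$ have $q$ orthonormal columns. Let $U_r$ and $V_r$ contain the first $r$ columns of $U$ and $V$, respectively. Let $$\widehat u\in\arg\min_{u\in\mathbb R_+^r}\left\{\lambda\|u-\boldsymbol\sigma_{1:r}\|^2+\rho\big((u,\mathbf 0_{q-r})\big)\right\}$$ and set $\widehat X:=U_r\,\mathrm{Diag}(\widehat u)V_r^\top$. (Symmetric-matrix setting.) Let $1\le r\le d$, and suppose $\mathcal R(X)=\rho(\boldsymbol\lambda(X))$ for $X\in\mathbb S^d$, where $\rho:\mathbb R^d\to\mathbb R\cup\{+\infty\}$ is permutation invariant and $\mathrm{dom}(\rho)\subseteq\mathbb R_+^d$. Fix $Y\in\mathbb S^d$ and $\lambda>0$, and let $Y=U\,\mathrm{Diag}(\boldsymbol\gamma)U^\top$, $\gamma_1\ge\dots\ge\gamma_d$, be an eigendecomposition. Let $U_r$ contain the first $r$ columns of $U$. Let $$\widehat u\in\arg\min_{u\in\mathbb R_+^r}\left\{\lambda\|u-\boldsymbol\gamma_{1:r}\|^2+\rho\big((u,\mathbf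 0_{d-r})\big)\right\}$$ and set $\widehat X:=U_r\,\mathrm{Diag}(\widehat u)U_r^\top$. In either setting, $$\widehat X\in\arg\min_{X\in\mathcal C_r}\left\{\lambda\|X-Y\|_F^2+\mathcal R(X)\right\}.$$ Consequently, if every $X^*\in\mathcal X^*$ has rank at most $r$, the corresponding construction implements a weak proximal oracle.
   Context: Setting: $\mathbb V$ is either $\mathbb R^{d_1\times d_2}$ (rectangular setting) or the space $\mathbb S^d$ of real symmetric $d\times d$ matrices (symmetric setting), endowed with the Frobenius norm $\|\cdot\|_F$. The problem is to minimize $F=f+\mathcal R$ over $\mathbb V$, with $f:\mathbb V\to\mathbb R$ closed and convex, $\mathcal R:\mathbb V\to\mathbb R\cup\{+\infty\}$ proper, closed and convex, and $\mathcal X^*:=\arg\min F$ nonempty; it is also a standing assumption that for some $\alpha>0$, $F(X)-\min F\ge\frac\alpha2\mathrm{dist}(X,\mathcal X^* )^2$ for all $X\in\mathrm{dom}(\mathcal R)$. The function $\rho$ is proper, closed and convex. Notation: $\boldsymbol\sigma(X)\in\mathbb R_+^q$ is the vector of singular values of $X$, $\boldsymbol\lambda(X)\in\mathbb R^d$ is the vector of eigenvalues of $X$; $a_{1:r}$ denotes the first $r$ entries of a vector $a$; $(u,\mathbf 0_{p})$ is $u$ padded with $p$ zeros; $\mathcal C_r:=\{X\in\mathrm{dom}(\mathcal R):\mathrm{rank}(X)\le r\}$. In the symmetric setting $\mathrm{dom}(\mathcal R)$ is contained in the positive semidefinite cone. Weak proximal oracle: a map $\mathcal A:\mathbb V\times\mathbb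 R_+\to\mathrm{dom}(\mathcal R)$ such that for every $Y\in\mathbb V$ and $\lambda>0$, the output $X=\mathcal A(Y,\lambda)$ satisfies $\lambda\|X-Y\|_F^2+\mathcal R(X)\le\lambda\|X^*-Y\|_F^2+\mathcal R(X^* )$ for all $X^*\in\mathcal X^*$. *)

theory Defs
  imports "HOL-Analysis.Analysis" "HOL-Computational_Algebra.Polynomial"
begin

section \<open>Extended-valued convex functions on a subset of a Euclidean space\<close>

text \<open>
  A function \<open>g\<close> on a set \<open>S\<close> is modelled by a total function of which only the values on \<open>S\<close>
  matter. For closed \<open>S\<close> (as in all uses below) closedness of the epigraph in the ambient
  space is the same as closedness relative to \<open>S\<close>.
\<close>

definition ereal_epigraph :: "'a set \<Rightarrow> ('a \<Rightarrow> ereal) \<Rightarrow> ('a \<times> real) set" where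
  "ereal_epigraph S g = {(x, t). x \<in> S \<and> g x \<le> ereal t}"

definition closed_convex_fun :: "'a::euclidean_space set \<Rightarrow> ('a \<Rightarrow> ereal) \<Rightarrow> bool" where
  "closed_convex_fun S g \<longleftrightarrow> closed (ereal_epigraph S g) \<and> convex (ereal_epigraph S g)"

definition dom_on :: "'a set \<Rightarrow> ('a \<Rightarrow> ereal) \<Rightarrow> 'a set" where
  "dom_on S g = {x \<in> S. g x < \<infinity>}"

definition proper_fun :: "'a set \<Rightarrow> ('a \<Rightarrow> ereal) \<Rightarrow> bool" where
  "proper_fun S g \<longleftrightarrow> dom_on S g \<noteq> {} \<and> (\<forall>x\<in>S. g x \<noteq> -\<infinity>)"

text \<open>
  As usual in convex analysis, a function that is identically \<open>\<infinity>\<close> on \<open>S\<close> has no minimizers.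
\<close>

definition argmin_set :: "'a set \<Rightarrow> ('a \<Rightarrow> ereal) \<Rightarrow> 'a set" where
  "argmin_set S g = {x. is_arg_min g (\<lambda>y. y \<in> S) x \<and> g x < \<infinity>}"

section \<open>Composite problem and weak proximal oracle\<close>

definition composite :: "('a \<Rightarrow> real) \<Rightarrow> ('a \<Rightarrow> ereal) \<Rightarrow> 'a \<Rightarrow> ereal" where
  "composite f R X = ereal (f X) + R X"

definition solutions :: "'a set \<Rightarrow> ('a \<Rightarrow> real) \<Rightarrow> ('a \<Rightarrow> ereal) \<Rightarrow> 'a set" where
  "solutions V f R = argmin_set V (composite f R)"

definition quadratic_growth ::
    "'a::euclidean_space set \<Rightarrow> ('a \<Rightarrow> real) \<Rightarrow> ('a \<Rightarrow> ereal) \<Rightarrow> bool" where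
  "quadratic_growth V f R \<longleftrightarrow>
     (\<exists>\<alpha>>0. \<forall>X\<in>dom_on V R.
        ereal (\<alpha> / 2 * (infdist X (solutions V f R))\<^sup>2)
          \<le> composite f R X - (INF Z\<in>V. composite f R Z))"

definition composite_problem ::
    "'a::euclidean_space set \<Rightarrow> ('a \<Rightarrow> real) \<Rightarrow> ('a \<Rightarrow> ereal) \<Rightarrow> bool" where
  "composite_problem V f R \<longleftrightarrow>
     closed_convex_fun V (\<lambda>X. ereal (f X)) \<and>
     proper_fun V R \<and> closed_convex_fun V R \<and>
     solutions V f R \<noteq> {} \<and> quadratic_growth V f R"

text \<open>On \<open>real ^ 'n ^ 'm\<close> the library norm is the Frobenius norm.\<close>

definition prox_objective ::
    "('a::real_normed_vector \<Rightarrow> ereal) \<Rightarrow> real \<Rightarrow> 'a \<Rightarrow> 'a \<Rightarrow> ereal" where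
  "prox_objective R lam Y X = ereal (lam * (norm (X - Y))\<^sup>2) + R X"

definition weak_prox_oracle ::
    "'a::euclidean_space set \<Rightarrow> ('a \<Rightarrow> real) \<Rightarrow> ('a \<Rightarrow> ereal) \<Rightarrow> ('a \<Rightarrow> real \<Rightarrow> 'a) \<Rightarrow> bool" where
  "weak_prox_oracle V f R A \<longleftrightarrow>
     (\<forall>Y\<in>V. \<forall>lam\<ge>0. A Y lam \<in> dom_on V R) \<and>
     (\<forall>Y\<in>V. \<forall>lam>0. \<forall>Xs\<in>solutions V f R.
        prox_objective R lam Y (A Y lam) \<le> prox_objective R lam Y Xs)"

section \<open>Vectors and matrices with ordered index types\<close>

text \<open>
  Entries of a vector indexed by a finite linear order are numbered \<open>0, 1, \<dots>\<close> in increasing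
  order of the index. This relates the entries of vectors of different dimension, so that
  \<open>first_entries a\<close> is the vector of the first \<open>CARD('r)\<close> entries of \<open>a\<close> and \<open>pad_zeros u\<close> is \<open>u\<close>
  followed by \<open>CARD('q) - CARD('r)\<close> zeros; both are meant for \<open>CARD('r) \<le> CARD('q)\<close>.
\<close>

definition position :: "'n::{finite,linorder} \<Rightarrow> nat" where
  "position i = card {..<i}"

definition at_position :: "nat \<Rightarrow> 'n::{finite,linorder}" where
  "at_position m = (THE i. position i = m)"

definition first_entries ::
    "'a ^ 'q::{finite,linorder} \<Rightarrow> 'a ^ 'r::{finite,linorder}" where
  "first_entries a = (\<chi> i. a $ at_position (position i))"

definition first_cols ::
    "real ^ 'q::{finite,linorder} ^ 'm \<Rightarrow> real ^ 'r::{finite,linorder} ^ 'm" where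
  "first_cols U = (\<chi> a. first_entries (U $ a))"

definition pad_zeros ::
    "real ^ 'r::{finite,linorder} \<Rightarrow> real ^ 'q::{finite,linorder}" where
  "pad_zeros u = (\<chi> k. if position k < CARD('r) then u $ at_position (position k) else 0)"

definition Diag :: "real ^ 'n \<Rightarrow> real ^ 'n ^ 'n" where
  "Diag v = (\<chi> i j. if i = j then v $ i else 0)"

definition nonneg_orthant :: "(real ^ 'n) set" where
  "nonneg_orthant = {x. \<forall>i. 0 \<le> x $ i}"

definition symmetric_matrices :: "(real ^ 'n ^ 'n) set" where
  "symmetric_matrices = {X. transpose X = X}"

definition permutation_invariant :: "(real ^ 'n) set \<Rightarrow> (real ^ 'n \<Rightarrow> ereal) \<Rightarrow> bool" where
  "permutation_invariant S \<rho> \<longleftrightarrow>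
     (\<forall>\<pi>. bij \<pi> \<longrightarrow> (\<forall>x\<in>S. \<rho> (\<chi> i. x $ \<pi> i) = \<rho> x))"

section \<open>Singular values and eigenvalues\<close>

text \<open>Thin singular value decomposition, meant for \<open>CARD('q) = min CARD('m) CARD('n)\<close>.\<close>

definition is_svd ::
    "real ^ 'n ^ 'm \<Rightarrow> real ^ 'q::{finite,linorder} ^ 'm \<Rightarrow> real ^ 'q::{finite,linorder} \<Rightarrow>
     real ^ 'q::{finite,linorder} ^ 'n \<Rightarrow> bool" where
  "is_svd X U s V \<longleftrightarrow>
     transpose U ** U = mat 1 \<and> transpose V ** V = mat 1 \<and>
     antimono (($) s) \<and> s \<in> nonneg_orthant \<and>
     X = U ** Diag s ** transpose V"

definition singular_values :: "real ^ 'n ^ 'm \<Rightarrow> real ^ 'q::{finite,linorder}" where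
  "singular_values X = (THE s. \<exists>U V. is_svd X U s V)"

definition is_eigendecomposition ::
    "real ^ 'n::{finite,linorder} ^ 'n::{finite,linorder} \<Rightarrow>
     real ^ 'n::{finite,linorder} ^ 'n::{finite,linorder} \<Rightarrow> real ^ 'n::{finite,linorder} \<Rightarrow> bool" where
  "is_eigendecomposition X U g \<longleftrightarrow>
     orthogonal_matrix U \<and> antimono (($) g) \<and> X = U ** Diag g ** transpose U"

definition charpoly :: "real ^ 'n ^ 'n \<Rightarrow> real poly" where
  "charpoly X = det (mat [:0, 1:] - map_matrix (\<lambda>a. [:a:]) X)"

text \<open>
  The eigenvalues, with multiplicity and in nonincreasing order, of a matrix whose
  characteristic polynomial splits over the reals.
\<close>

definition eigenvalues ::
    "real ^ 'n::{finite,linorder} ^ 'n::{finite,linorder} \<Rightarrow> real ^ 'n::{finite,linorder}" where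
  "eigenvalues X =
     (THE l. antimono (($) l) \<and> charpoly X = (\<Prod>i\<in>UNIV. [:- (l $ i), 1:]))"

section \<open>Low-rank construction\<close>

definition low_rank_dom ::
    "(real ^ 'n ^ 'm) set \<Rightarrow> (real ^ 'n ^ 'm \<Rightarrow> ereal) \<Rightarrow> nat \<Rightarrow> (real ^ 'n ^ 'm) set" where
  "low_rank_dom V R r = {X \<in> dom_on V R. rank X \<le> r}"

definition reduced_minimizers ::
    "(real ^ 'q::{finite,linorder} \<Rightarrow> ereal) \<Rightarrow> real \<Rightarrow> real ^ 'q::{finite,linorder} \<Rightarrow>
     (real ^ 'r::{finite,linorder}) set" where
  "reduced_minimizers \<rho> lam s =
     argmin_set nonneg_orthant
       (\<lambda>u. ereal (lam * (norm (u - first_entries s))\<^sup>2) + \<rho> (pad_zeros u))"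

definition low_rank_matrix ::
    "real ^ 'q::{finite,linorder} ^ 'm \<Rightarrow> real ^ 'r::{finite,linorder} \<Rightarrow>
     real ^ 'q::{finite,linorder} ^ 'n \<Rightarrow> real ^ 'n ^ 'm" where
  "low_rank_matrix U u V = first_cols U ** Diag u ** transpose (first_cols V)"

end

theory Submission
  imports Defs
begin

text \<open>
  If \<open>X\<close> has rank at most \<open>r\<close> and spectrum \<open>g\<close> (nonnegative, in decreasing order), then
  \<open>g = (x, 0)\<close> for the vector \<open>x\<close> of its first \<open>r\<close> entries, and von Neumann's trace inequality gives
  \<open>|X - Y|\<^sup>2 \<ge> |x - s\<^sub>1\<^sub>:\<^sub>r|\<^sup>2 + |Y|\<^sup>2 - |s\<^sub>1\<^sub>:\<^sub>r|\<^sup>2\<close>, where \<open>s\<close> is the spectrum of \<open>Y\<close>. Equality holds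
  for the constructed matrix, whose spectrum is \<open>(u, 0)\<close> up to order, so the matrix problem reduces
  to the vector problem solved by \<open>u\<close>. Uniqueness of singular values is itself a consequence of
  the trace inequality, and the spectral theorem follows from the existence of singular value
  decompositions applied to \<open>X + c I\<close> with \<open>c\<close> large.
\<close>

text \<open>Three obstacles shape the argument. A minimizer \<open>u\<close> of the reduced problem
  need not be decreasing, so the constructed matrix does not come with a sorted decomposition; the
  permutation that sorts its spectrum is absorbed by the invariance of \<open>\<rho>\<close>. In the
  symmetric setting \<open>Y\<close> may be indefinite, so its eigendecomposition is not a singular
  value decomposition. Adding a multiple of the identity makes it one, and in the trace inequality
  this shift adds the same multiple of the trace of the competitor to both sides. Competitors, in
  contrast, have nonnegative eigenvalues, because \<open>\<rho>\<close> is finite only on the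
  orthant. The spectral theorem uses a shift for another reason: for a negative eigenvalue, left and
  right singular vectors can be opposite, and positive definiteness excludes this. Finally, the
  oracle statement would be empty if reduced minimizers did not exist; the spectrum of a solution of
  rank at most \<open>r\<close> supplies the point of finite value from which their existence is
  derived.\<close>

section \<open>Decreasing rearrangements\<close>

text \<open>Induction on the largest index \<open>b\<close>, where \<open>s\<close> and
  \<open>t\<close> are smallest. Subtracting the constants \<open>s b\<close> and \<open>t b\<close>
  leaves decreasing nonnegative vectors that vanish at \<open>b\<close>, so their double sum lives
  on \<open>I\<close> and the induction hypothesis applies.\<close>

lemma sum_substochastic_le:
  fixes s t :: "'a::linorder \<Rightarrow> real" and d :: "'a \<Rightarrow> 'a \<Rightarrow> real"
  assumes "finite I"
    and "\<And>i j. i \<in> I \<Longrightarrow> j \<in> I \<Longrightarrow> 0 \<le> d i j"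
    and "\<And>i. i \<in> I \<Longrightarrow> (\<Sum>j\<in>I. d i j) \<le> 1"
    and "\<And>j. j \<in> I \<Longrightarrow> (\<Sum>i\<in>I. d i j) \<le> 1"
    and "\<And>i. i \<in> I \<Longrightarrow> 0 \<le> s i" and "\<And>i. i \<in> I \<Longrightarrow> 0 \<le> t i"
    and "\<And>i j. i \<in> I \<Longrightarrow> j \<in> I \<Longrightarrow> i \<le> j \<Longrightarrow> s j \<le> s i"
    and "\<And>i j. i \<in> I \<Longrightarrow> j \<in> I \<Longrightarrow> i \<le> j \<Longrightarrow> t j \<le> t i"
  shows "(\<Sum>i\<in>I. \<Sum>j\<in>I. d i j * (s i * t j)) \<le> (\<Sum>i\<in>I. s i * t i)"
  using assms
proof (induction I arbitrary: s t rule: finite_linorder_max_induct)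
  case empty
  then show ?case by simp
next
  case (insert b I)
  let ?J = "insert b I"
  define p where "p i = s i - s b" for i
  define q where "q i = t i - t b" for i
  have bI: "b \<notin> I" using insert.hyps(2) by blast
  have d0: "0 \<le> d i j" if "i \<in> ?J" "j \<in> ?J" for i j
    using insert.prems(1) that by blast
  have le_b: "i \<le> b" if "i \<in> ?J" for i
    using that insert.hyps(2) by (auto intro: less_imp_le)
  have p0: "0 \<le> p i" and q0: "0 \<le> q i" if "i \<in> ?J" for i
    using insert.prems(6)[OF that insertI1 le_b[OF that]]
      insert.prems(7)[OF that insertI1 le_b[OF that]]
    by (simp_all add: p_def q_def)
  have rows: "(\<Sum>j\<in>I. d i j) \<le> 1" if "i \<in> I" for i
    using insert.prems(2)[of i] d0[of i b] that bI insert.hyps(1) by simp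
  have cols: "(\<Sum>i\<in>I. d i j) \<le> 1" if "j \<in> I" for j
    using insert.prems(3)[of j] d0[of b j] that bI insert.hyps(1) by simp
  have IH: "(\<Sum>i\<in>I. \<Sum>j\<in>I. d i j * (p i * q j)) \<le> (\<Sum>i\<in>I. p i * q i)"
  proof (rule insert.IH)
    show "0 \<le> d i j" if "i \<in> I" "j \<in> I" for i j using d0 that by blast
    show "p j \<le> p i" if "i \<in> I" "j \<in> I" "i \<le> j" for i j
      using insert.prems(6)[of i j] that by (simp add: p_def)
    show "q j \<le> q i" if "i \<in> I" "j \<in> I" "i \<le> j" for i j
      using insert.prems(7)[of i j] that by (simp add: q_def)
  qed (use rows cols p0 q0 in auto)
  have pb: "p b = 0" "q b = 0" by (simp_all add: p_def q_def)
  have main: "(\<Sum>i\<in>?J. \<Sum>j\<in>?J. d i j * (p i * q j)) \<le> (\<Sum>i\<in>?J. p i * q i)"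
    using IH bI insert.hyps(1) by (simp add: pb)
  have c1: "(\<Sum>i\<in>?J. \<Sum>j\<in>?J. d i j * (t b * p i)) \<le> (\<Sum>i\<in>?J. t b * p i)"
  proof (rule sum_mono)
    fix i assume i: "i \<in> ?J"
    have "(\<Sum>j\<in>?J. d i j * (t b * p i)) = (\<Sum>j\<in>?J. d i j) * (t b * p i)"
      by (rule sum_distrib_right[symmetric])
    also have "\<dots> \<le> 1 * (t b * p i)"
      using insert.prems(2)[OF i] insert.prems(5)[of b] p0[OF i]
      by (intro mult_right_mono) auto
    finally show "(\<Sum>j\<in>?J. d i j * (t b * p i)) \<le> t b * p i" by simp
  qed
  have c2: "(\<Sum>j\<in>?J. \<Sum>i\<in>?J. d i j * (s b * t j)) \<le> (\<Sum>j\<in>?J. s b * t j)"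
  proof (rule sum_mono)
    fix j assume j: "j \<in> ?J"
    have "(\<Sum>i\<in>?J. d i j * (s b * t j)) = (\<Sum>i\<in>?J. d i j) * (s b * t j)"
      by (rule sum_distrib_right[symmetric])
    also have "\<dots> \<le> 1 * (s b * t j)"
      using insert.prems(3)[OF j] insert.prems(4)[of b] insert.prems(5)[OF j]
      by (intro mult_right_mono) auto
    finally show "(\<Sum>i\<in>?J. d i j * (s b * t j)) \<le> s b * t j" by simp
  qed
  \<comment> \<open>This is \<open>s i * t j = p i * q j + t b * p i + s b * t j\<close>. The first
    term is the reduced problem, the second is bounded by the row sums, the third by the column
    sums.\<close>
  have "(\<Sum>i\<in>?J. \<Sum>j\<in>?J. d i j * (s i * t j))
      = (\<Sum>i\<in>?J. \<Sum>j\<in>?J. d i j * (p i * q j)) + (\<Sum>i\<in>?J. \<Sum>j\<in>?J. d i j * (t b * p i))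
        + (\<Sum>i\<in>?J. \<Sum>j\<in>?J. d i j * (s b * t j))"
    unfolding sum.distrib[symmetric]
    by (intro sum.cong refl) (simp add: p_def q_def algebra_simps)
  also have "(\<Sum>i\<in>?J. \<Sum>j\<in>?J. d i j * (s b * t j)) = (\<Sum>j\<in>?J. \<Sum>i\<in>?J. d i j * (s b * t j))"
    by (rule sum.swap)
  also have "(\<Sum>i\<in>?J. \<Sum>j\<in>?J. d i j * (p i * q j)) + (\<Sum>i\<in>?J. \<Sum>j\<in>?J. d i j * (t b * p i))
        + (\<Sum>j\<in>?J. \<Sum>i\<in>?J. d i j * (s b * t j))
      \<le> (\<Sum>i\<in>?J. p i * q i) + (\<Sum>i\<in>?J. t b * p i) + (\<Sum>i\<in>?J. s b * t i)"
    using main c1 c2 by linarith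
  also have "\<dots> = (\<Sum>i\<in>?J. s i * t i)"
    unfolding sum.distrib[symmetric]
    by (intro sum.cong refl) (simp add: p_def q_def algebra_simps)
  finally show ?case .
qed

text \<open>Selection sort: the largest index is sent to a minimizer of \<open>w\<close>. The target
  \<open>J\<close> is a set of its own because the recursion removes \<open>b\<close> from
  \<open>I\<close> but \<open>m\<close> from \<open>J\<close>.\<close>

lemma ex_decreasing_bij_betw:
  fixes w :: "'b \<Rightarrow> real" and I :: "'a::linorder set"
  assumes "finite I" "finite J" "card J = card I"
  shows "\<exists>\<pi>. bij_betw \<pi> I J \<and> (\<forall>i\<in>I. \<forall>j\<in>I. i \<le> j \<longrightarrow> w (\<pi> j) \<le> w (\<pi> i))"
  using assms
proof (induction I arbitrary: J rule: finite_linorder_max_induct)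
  case empty
  then show ?case by (simp add: bij_betw_def)
next
  case (insert b I)
  have "J \<noteq> {}" using insert by auto
  then obtain m where m: "m \<in> J" "\<And>j. j \<in> J \<Longrightarrow> w m \<le> w j"
    using arg_min_if_finite(1)[OF insert.prems(1)] arg_min_least[OF insert.prems(1)] by metis
  have bI: "b \<notin> I" using insert.hyps(2) by blast
  have "card (J - {m}) = card I"
    using insert.prems insert.hyps(1) bI m(1) by simp
  then obtain \<pi> where \<pi>: "bij_betw \<pi> I (J - {m})" "\<forall>i\<in>I. \<forall>j\<in>I. i \<le> j \<longrightarrow> w (\<pi> j) \<le> w (\<pi> i)"
    using insert.IH[of "J - {m}"] insert.prems(1) by auto
  let ?\<pi> = "\<pi>(b := m)"
  have "bij_betw ?\<pi> I (J - {m})"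
    using \<pi>(1) bI by (subst bij_betw_cong[where g = \<pi>]) auto
  then have "bij_betw ?\<pi> (insert b I) J"
    using notIn_Un_bij_betw[of b I ?\<pi> "J - {m}"] bI m(1) by (simp add: insert_absorb)
  moreover have "w (?\<pi> j) \<le> w (?\<pi> i)" if "i \<in> insert b I" "j \<in> insert b I" "i \<le> j" for i j
  proof (cases "j = b")
    case True
    have "?\<pi> i \<in> J" using that(1) m(1) bij_betwE[OF \<pi>(1)] by auto
    then show ?thesis using True m(2) by simp
  next
    case False
    then show ?thesis using that \<pi>(2) insert.hyps(2) by force
  qed
  ultimately show ?case by blast
qed

lemma ex_decreasing_permutation:
  fixes w :: "real ^ 'q::{finite,linorder}"
  obtains \<pi> :: "'q \<Rightarrow> 'q" where "bij \<pi>" "antimono (($) (\<chi> i. w $ \<pi> i))"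
proof -
  obtain \<pi> :: "'q \<Rightarrow> 'q" where "bij \<pi>" "\<forall>i j. i \<le> j \<longrightarrow> w $ \<pi> j \<le> w $ \<pi> i"
    using ex_decreasing_bij_betw[of "UNIV :: 'q set" "UNIV :: 'q set" "($) w"] by auto
  then show thesis by (intro that[of \<pi>]) (auto simp: monotone_def)
qed

text \<open>At the largest index both families take the smallest root of the common polynomial.
  These values agree, and cancelling the corresponding linear factor leaves the smaller index
  set.\<close>

lemma decreasing_eq_if_prod_linear_factors_eq:
  fixes l m :: "'a::linorder \<Rightarrow> real"
  assumes "finite I"
    and "\<And>i j. i \<in> I \<Longrightarrow> j \<in> I \<Longrightarrow> i \<le> j \<Longrightarrow> l j \<le> l i"
    and "\<And>i j. i \<in> I \<Longrightarrow> j \<in> I \<Longrightarrow> i \<le> j \<Longrightarrow> m j \<le> m i"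
    and "(\<Prod>i\<in>I. [:- l i, 1:]) = (\<Prod>i\<in>I. [:- m i, 1:])"
  shows "\<forall>i\<in>I. l i = m i"
  using assms
proof (induction I rule: finite_linorder_max_induct)
  case empty
  then show ?case by simp
next
  case (insert b I)
  let ?J = "insert b I"
  have finJ: "finite ?J" and bI: "b \<notin> I" using insert.hyps by auto
  have root: "(\<exists>i\<in>?J. f i = x) \<longleftrightarrow> poly (\<Prod>i\<in>?J. [:- f i, 1:]) x = 0" for f :: "'a \<Rightarrow> real" and x
    using finJ by (auto simp only: poly_prod prod_zero_iff) auto
  have le: "g b \<le> f b"
    if "\<And>i j. i \<in> ?J \<Longrightarrow> j \<in> ?J \<Longrightarrow> i \<le> j \<Longrightarrow> g j \<le> g i"
      and eq: "(\<Prod>i\<in>?J. [:- f i, 1:]) = (\<Prod>i\<in>?J. [:- g i, 1:])" for f g :: "'a \<Rightarrow> real"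
  proof -
    have "\<exists>i\<in>?J. g i = f b" using root[of f "f b"] root[of g "f b"] eq by auto
    then obtain i where "i \<in> ?J" "g i = f b" by blast
    then show ?thesis using that(1)[of i b] insert.hyps(2) by fastforce
  qed
  have b: "l b = m b"
    using le[of l m] le[of m l] insert.prems by (intro antisym) auto
  have "(\<Prod>i\<in>I. [:- l i, 1:]) = (\<Prod>i\<in>I. [:- m i, 1:])"
    using insert.prems(3) bI insert.hyps(1) b by (simp del: mult_pCons_left)
  then have "\<forall>i\<in>I. l i = m i"
    by (rule insert.IH[rotated 2]) (use insert.prems(1,2) in blast)+
  then show ?case using b by simp
qed

section \<open>Von Neumann's trace inequality\<close>

lemma svd_entry: "(U ** Diag s ** transpose V) $ a $ b = (\<Sum>k\<in>UNIV. U $ a $ k * s $ k * V $ b $ k)"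
  by (simp add: matrix_matrix_mult_def transpose_def Diag_def if_distrib cong: if_cong)

lemma Diag_mult_vec: "Diag s *v x = (\<chi> k. s $ k * x $ k)"
  by (simp add: matrix_vector_mult_def Diag_def if_distrib[of "\<lambda>x. x * _"] cong: if_cong)

lemma inner_svd:
  fixes U :: "real ^ 'q ^ 'm" and V :: "real ^ 'q ^ 'n" and U' :: "real ^ 'p ^ 'm" and V' :: "real ^ 'p ^ 'n"
  shows "(U ** Diag s ** transpose V) \<bullet> (U' ** Diag t ** transpose V')
    = (\<Sum>i\<in>UNIV. \<Sum>j\<in>UNIV. (transpose U ** U') $ i $ j * (transpose V ** V') $ i $ j * (s $ i * t $ j))"
proof -
  have "(U ** Diag s ** transpose V) \<bullet> (U' ** Diag t ** transpose V')
     = (\<Sum>a\<in>UNIV. \<Sum>b\<in>UNIV. \<Sum>i\<in>UNIV. \<Sum>j\<in>UNIV. (U $ a $ i * s $ i * V $ b $ i) * (U' $ a $ j * t $ j * V' $ b $ j))"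
    by (simp add: inner_vec_def svd_entry sum_product)
  also have "\<dots> = (\<Sum>a\<in>UNIV. \<Sum>i\<in>UNIV. \<Sum>b\<in>UNIV. \<Sum>j\<in>UNIV. (U $ a $ i * s $ i * V $ b $ i) * (U' $ a $ j * t $ j * V' $ b $ j))"
    by (intro sum.cong refl sum.swap)
  also have "\<dots> = (\<Sum>i\<in>UNIV. \<Sum>a\<in>UNIV. \<Sum>b\<in>UNIV. \<Sum>j\<in>UNIV. (U $ a $ i * s $ i * V $ b $ i) * (U' $ a $ j * t $ j * V' $ b $ j))"
    by (rule sum.swap)
  also have "\<dots> = (\<Sum>i\<in>UNIV. \<Sum>a\<in>UNIV. \<Sum>j\<in>UNIV. \<Sum>b\<in>UNIV. (U $ a $ i * s $ i * V $ b $ i) * (U' $ a $ j * t $ j * V' $ b $ j))"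
    by (intro sum.cong refl sum.swap)
  also have "\<dots> = (\<Sum>i\<in>UNIV. \<Sum>j\<in>UNIV. \<Sum>a\<in>UNIV. \<Sum>b\<in>UNIV. (U $ a $ i * s $ i * V $ b $ i) * (U' $ a $ j * t $ j * V' $ b $ j))"
    by (intro sum.cong refl sum.swap)
  also have "\<dots> = (\<Sum>i\<in>UNIV. \<Sum>j\<in>UNIV. (transpose U ** U') $ i $ j * (transpose V ** V') $ i $ j * (s $ i * t $ j))"
  proof (intro sum.cong refl)
    fix i j
    have *: "(transpose U ** U') $ i $ j * (transpose V ** V') $ i $ j
       = (\<Sum>a\<in>UNIV. \<Sum>b\<in>UNIV. (U $ a $ i * U' $ a $ j) * (V $ b $ i * V' $ b $ j))"
      by (simp add: matrix_matrix_mult_def transpose_def sum_product)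
    show "(\<Sum>a\<in>UNIV. \<Sum>b\<in>UNIV. (U $ a $ i * s $ i * V $ b $ i) * (U' $ a $ j * t $ j * V' $ b $ j))
       = (transpose U ** U') $ i $ j * (transpose V ** V') $ i $ j * (s $ i * t $ j)"
      unfolding * sum_distrib_right by (intro sum.cong refl) (simp add: mult_ac)
  qed
  finally show ?thesis .
qed

text \<open>The equality case of the trace inequality. It is applied to the unsorted vector
  \<open>pad_zeros u\<close> and to eigenvalues of either sign.\<close>

lemma inner_svd_same:
  assumes "transpose U ** U = mat 1" "transpose V ** V = mat 1"
  shows "(U ** Diag s ** transpose V) \<bullet> (U ** Diag t ** transpose V) = s \<bullet> t"
  unfolding inner_svd assms
  by (simp add: mat_def inner_vec_def if_distrib[of "\<lambda>x. x * _"] cong: if_cong)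

lemma norm_svd:
  assumes "transpose U ** U = mat 1" "transpose V ** V = mat 1"
  shows "norm (U ** Diag s ** transpose V) = norm s"
  unfolding norm_eq_sqrt_inner inner_svd_same[OF assms] ..

lemma norm_orthonormal_columns:
  fixes U :: "real ^ 'q ^ 'm"
  assumes "transpose U ** U = mat 1"
  shows "norm (U *v x) = norm x"
proof -
  have "(U *v x) \<bullet> (U *v x) = ((U *v x) v* U) \<bullet> x" by (simp add: dot_lmul_matrix)
  also have "\<dots> = (transpose U *v (U *v x)) \<bullet> x" by simp
  also have "\<dots> = x \<bullet> x" by (simp only: matrix_vector_mul_assoc assms matrix_vector_mul_lid)
  finally show ?thesis by (simp add: norm_eq_sqrt_inner)
qed

text \<open>The transpose of an isometry is a contraction:
  \<open>|x v* U|^2 = x \<bullet> U (x v* U) \<le> |x| |x v* U|\<close>, and one factor cancels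
  unless it is zero.\<close>

lemma bessel_columns:
  fixes U :: "real ^ 'q ^ 'm"
  assumes "transpose U ** U = mat 1"
  shows "norm (x v* U) \<le> norm x"
proof (cases "x v* U = 0")
  case False
  have "(x v* U) \<bullet> (x v* U) = x \<bullet> (U *v (x v* U))" by (rule dot_lmul_matrix)
  also have "\<dots> \<le> norm x * norm (x v* U)"
    using norm_cauchy_schwarz[of x "U *v (x v* U)"] norm_orthonormal_columns[OF assms] by simp
  finally show ?thesis using False by (simp add: dot_square_norm power2_eq_square)
qed simp

text \<open>Row \<open>i\<close> of \<open>transpose U ** W\<close> lists the coordinates of the
  unit vector \<open>column i U\<close> along the orthonormal columns of \<open>W\<close>.\<close>

lemma sum_squares_row_le_1:
  fixes U :: "real ^ 'p ^ 'm" and W :: "real ^ 'q ^ 'm"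
  assumes "transpose U ** U = mat 1" "transpose W ** W = mat 1"
  shows "(\<Sum>j\<in>UNIV. ((transpose U ** W) $ i $ j)\<^sup>2) \<le> 1"
proof -
  have "column i U \<bullet> column i U = (transpose U ** U) $ i $ i"
    by (simp add: inner_vec_def column_def matrix_matrix_mult_def transpose_def)
  then have 1: "norm (column i U) = 1" by (simp add: assms mat_def norm_eq_1)
  have "(\<Sum>j\<in>UNIV. ((transpose U ** W) $ i $ j)\<^sup>2) = (norm (column i U v* W))\<^sup>2"
    unfolding power2_norm_eq_inner
    by (simp add: inner_vec_def column_def matrix_matrix_mult_def vector_matrix_mult_def transpose_def
        power2_eq_square mult_ac)
  also have "\<dots> \<le> 1"
    using bessel_columns[OF assms(2), of "column i U"] 1 by (simp add: power_le_one)
  finally show ?thesis .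
qed

lemma sum_squares_column_le_1:
  fixes U :: "real ^ 'p ^ 'm" and W :: "real ^ 'q ^ 'm"
  assumes "transpose U ** U = mat 1" "transpose W ** W = mat 1"
  shows "(\<Sum>i\<in>UNIV. ((transpose U ** W) $ i $ j)\<^sup>2) \<le> 1"
proof -
  have "(transpose U ** W) $ i $ j = (transpose W ** U) $ j $ i" for i
    by (simp add: matrix_matrix_mult_def transpose_def mult_ac)
  then show ?thesis using sum_squares_row_le_1[OF assms(2,1)] by simp
qed

text \<open>
  Von Neumann's trace inequality: with \<open>d\<close> the average of the entrywise squares of
  \<open>U\<^sup>T W\<close> and \<open>V\<^sup>T Z\<close>, Bessel's inequality makes \<open>d\<close> doubly substochastic.
\<close>

lemma von_neumann_trace:
  assumes X: "is_svd X U s V" and Y: "is_svd Y W t Z"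
  shows "X \<bullet> Y \<le> s \<bullet> t"
proof -
  note x = X[unfolded is_svd_def nonneg_orthant_def monotone_def]
    and y = Y[unfolded is_svd_def nonneg_orthant_def monotone_def]
  define P where "P = transpose U ** W"
  define Q where "Q = transpose V ** Z"
  define d where "d i j = ((P $ i $ j)\<^sup>2 + (Q $ i $ j)\<^sup>2) / 2" for i j
  have rows: "(\<Sum>j\<in>UNIV. d i j) \<le> 1" for i
    using sum_squares_row_le_1[of U W i] sum_squares_row_le_1[of V Z i] x y
    by (simp add: d_def P_def Q_def sum.distrib flip: sum_divide_distrib)
  have cols: "(\<Sum>i\<in>UNIV. d i j) \<le> 1" for j
    using sum_squares_column_le_1[of U W j] sum_squares_column_le_1[of V Z j] x y
    by (simp add: d_def P_def Q_def sum.distrib flip: sum_divide_distrib)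
  \<comment> \<open>By the inequality of arithmetic and geometric means. The products may be
    negative, whereas \<open>d\<close> is nonnegative, as the rearrangement bound demands.\<close>
  have pq: "P $ i $ j * Q $ i $ j \<le> d i j" for i j
    using sum_squares_bound[of "P $ i $ j" "Q $ i $ j"] by (simp add: d_def)
  have "X \<bullet> Y = (\<Sum>i\<in>UNIV. \<Sum>j\<in>UNIV. P $ i $ j * Q $ i $ j * (s $ i * t $ j))"
    using x y inner_svd[of U s V W t Z] by (simp add: P_def Q_def)
  also have "\<dots> \<le> (\<Sum>i\<in>UNIV. \<Sum>j\<in>UNIV. d i j * (s $ i * t $ j))"
    using x y by (intro sum_mono mult_right_mono pq) auto
  also have "\<dots> \<le> (\<Sum>i\<in>UNIV. s $ i * t $ i)"
    using x y rows cols by (intro sum_substochastic_le) (auto simp: d_def)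
  finally show ?thesis by (simp add: inner_vec_def)
qed

text \<open>Pairing \<open>X\<close> with itself gives \<open>|X|^2 \<le> s \<bullet> t\<close>,
  while \<open>s\<close> and \<open>t\<close> both have norm \<open>|X|\<close>; this is the
  equality case of Cauchy-Schwarz.\<close>

lemma is_svd_unique:
  assumes "is_svd X U s V" "is_svd X W t Z"
  shows "s = t"
proof -
  have "norm X = norm s" "norm X = norm t"
    using assms unfolding is_svd_def by (metis norm_svd)+
  then have "X \<bullet> X = s \<bullet> s" "X \<bullet> X = t \<bullet> t" by (simp_all add: dot_square_norm)
  moreover have "X \<bullet> X \<le> s \<bullet> t" using von_neumann_trace assms .
  ultimately have "(s - t) \<bullet> (s - t) \<le> 0" by (simp add: inner_diff inner_commute)
  then have "(s - t) \<bullet> (s - t) = 0" by (intro antisym) auto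
  then show ?thesis by simp
qed

lemma singular_values_eqI: "is_svd X U s V \<Longrightarrow> singular_values X = s"
  unfolding singular_values_def using is_svd_unique by blast

section \<open>Reordering the columns of a factorization\<close>

lemma permute_columns_svd:
  fixes U :: "real ^ 'q ^ 'm" and V :: "real ^ 'q ^ 'n" and \<pi> :: "'q \<Rightarrow> 'q"
  assumes "bij \<pi>"
  shows "(\<chi> a k. U $ a $ \<pi> k) ** Diag (\<chi> k. s $ \<pi> k) ** transpose (\<chi> b k. V $ b $ \<pi> k)
    = U ** Diag s ** transpose V"
proof -
  have "(\<Sum>k\<in>UNIV. U $ a $ \<pi> k * s $ \<pi> k * V $ b $ \<pi> k) = (\<Sum>k\<in>UNIV. U $ a $ k * s $ k * V $ b $ k)"
    for a b
    by (rule sum.reindex_bij_betw[OF assms])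
  then show ?thesis by (simp add: vec_eq_iff svd_entry)
qed

lemma permute_columns_orthonormal:
  fixes U :: "real ^ 'q ^ 'm" and \<pi> :: "'q \<Rightarrow> 'q"
  assumes "bij \<pi>" "transpose U ** U = mat 1"
  shows "transpose (\<chi> a k. U $ a $ \<pi> k) ** (\<chi> a k. U $ a $ \<pi> k) = (mat 1 :: real ^ 'q ^ 'q)"
proof -
  have "(transpose (\<chi> a k. U $ a $ \<pi> k) ** (\<chi> a k. U $ a $ \<pi> k)) $ i $ j = (transpose U ** U) $ \<pi> i $ \<pi> j"
    for i j
    by (simp add: matrix_matrix_mult_def transpose_def)
  then show ?thesis
    using bij_is_inj[OF assms(1)]
    by (simp add: vec_eq_iff assms mat_def inj_eq)
qed

text \<open>Turns a factorization with diagonal in arbitrary order into a sorted one. It serves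
  singular triples that are found in no particular order, and the constructed matrix, whose diagonal
  \<open>pad_zeros u\<close> need not decrease.\<close>

lemma is_svd_sorted:
  fixes U :: "real ^ 'q::{finite,linorder} ^ 'm" and V :: "real ^ 'q::{finite,linorder} ^ 'n"
    and \<pi> :: "'q::{finite,linorder} \<Rightarrow> 'q"
  assumes "transpose U ** U = mat 1" "transpose V ** V = mat 1" "s \<in> nonneg_orthant"
    "bij \<pi>" "antimono (($) (\<chi> i. s $ \<pi> i))"
  shows "is_svd (U ** Diag s ** transpose V) (\<chi> a k. U $ a $ \<pi> k) (\<chi> i. s $ \<pi> i) (\<chi> b k. V $ b $ \<pi> k)"
  unfolding is_svd_def using assms
  by (simp only: permute_columns_svd permute_columns_orthonormal) (auto simp: nonneg_orthant_def)

section \<open>Existence of singular value and eigenvalue decompositions\<close>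

lemma ex_unit_orthogonal:
  fixes v :: "'i \<Rightarrow> 'a::euclidean_space"
  assumes "finite I" "card I < DIM('a)"
  obtains x where "norm x = 1" "\<And>i. i \<in> I \<Longrightarrow> v i \<bullet> x = 0"
proof -
  have "dim (v ` I) < DIM('a)"
    using dim_le_card'[of "v ` I"] card_image_le[of I v] assms by simp
  then obtain y where y: "y \<noteq> 0" "\<And>z. z \<in> span (v ` I) \<Longrightarrow> orthogonal y z"
    using orthogonal_to_subspace_exists by blast
  show thesis
  proof (rule that[of "y /\<^sub>R norm y"])
    show "v i \<bullet> (y /\<^sub>R norm y) = 0" if "i \<in> I" for i
      using y(2)[of "v i"] that by (simp add: orthogonal_def span_base inner_commute)
  qed (use y(1) in simp)
qed

text \<open>
  Singular triples are split off one at a time: a maximizer of \<open>y \<bullet> X x\<close> over unit vectors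
  orthogonal to the earlier ones is a singular pair, since the normalized \<open>X x\<close> is itself feasible.
\<close>

lemma ex_singular_triples:
  fixes X :: "real ^ 'n ^ 'm" and I :: "'i set"
  assumes "finite I" "card I \<le> CARD('m)" "card I \<le> CARD('n)"
  shows "\<exists>u v s. (\<forall>i\<in>I. X *v v i = s i *\<^sub>R u i \<and> u i v* X = s i *\<^sub>R v i \<and> (0::real) \<le> s i) \<and>
    (\<forall>i\<in>I. \<forall>j\<in>I. u i \<bullet> u j = (if i = j then 1 else 0) \<and> v i \<bullet> v j = (if i = j then 1 else 0))"
  using assms
proof (induction I rule: finite_induct)
  case empty
  then show ?case by simp
next
  case (insert k I)
  then obtain u v s where
    uv: "\<And>i. i \<in> I \<Longrightarrow> X *v v i = s i *\<^sub>R u i" "\<And>i. i \<in> I \<Longrightarrow> u i v* X = s i *\<^sub>R v i"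
        "\<And>i. i \<in> I \<Longrightarrow> (0::real) \<le> s i"
    and orth: "\<And>i j. i \<in> I \<Longrightarrow> j \<in> I \<Longrightarrow> u i \<bullet> u j = (if i = j then 1 else 0)"
      "\<And>i j. i \<in> I \<Longrightarrow> j \<in> I \<Longrightarrow> v i \<bullet> v j = (if i = j then 1 else 0)"
    by force
  define S where "S = sphere 0 1 \<inter> (\<Inter>i\<in>I. {x. v i \<bullet> x = 0})"
  define T where "T = sphere 0 1 \<inter> (\<Inter>i\<in>I. {y. u i \<bullet> y = 0})"
  have "compact S" "compact T"
    unfolding S_def T_def by (intro compact_Int_closed closed_INT ballI closed_hyperplane compact_sphere)+
  then have "compact (S \<times> T)" by (rule compact_Times)
  have "card I < DIM(real ^ 'n)" "card I < DIM(real ^ 'm)"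
    using insert.prems insert.hyps by simp_all
  then obtain a b where "norm a = 1" "\<And>i. i \<in> I \<Longrightarrow> v i \<bullet> a = 0" "norm b = 1" "\<And>i. i \<in> I \<Longrightarrow> u i \<bullet> b = 0"
    using ex_unit_orthogonal[OF insert.hyps(1)] by metis
  then have "S \<times> T \<noteq> {}"
    by (auto simp: S_def T_def)
  have "continuous_on (S \<times> T) (\<lambda>p. snd p \<bullet> (X *v fst p))"
    by (intro continuous_intros bounded_linear.continuous_on[OF matrix_vector_mul_bounded_linear])
  then obtain p where "p \<in> S \<times> T"
    and p: "\<And>q. q \<in> S \<times> T \<Longrightarrow> snd q \<bullet> (X *v fst q) \<le> snd p \<bullet> (X *v fst p)"
    using continuous_attains_sup[OF \<open>compact (S \<times> T)\<close> \<open>S \<times> T \<noteq> {}\<close>] by blast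
  define x y c where "x = fst p" and "y = snd p" and "c = y \<bullet> (X *v x)"
  have x: "x \<in> S" and y: "y \<in> T" and max: "\<And>x' y'. x' \<in> S \<Longrightarrow> y' \<in> T \<Longrightarrow> y' \<bullet> (X *v x') \<le> c"
    using \<open>p \<in> S \<times> T\<close> p by (auto simp: x_def y_def c_def)
  have nx: "x \<bullet> x = 1" "\<And>i. i \<in> I \<Longrightarrow> v i \<bullet> x = 0"
    using x by (auto simp: S_def dot_square_norm)
  have ny: "y \<bullet> y = 1" "\<And>i. i \<in> I \<Longrightarrow> u i \<bullet> y = 0"
    using y by (auto simp: T_def dot_square_norm)
  \<comment> \<open>Replacing \<open>y\<close> by its negative changes the sign of the objective, so
    the maximum cannot be negative.\<close>
  have "- y \<in> T" using y by (auto simp: T_def)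
  from max[OF x this] have c0: "0 \<le> c" by (simp add: c_def)
  have norm_le: "norm (X *v x) \<le> c"
  proof (cases "X *v x = 0")
    case False
    have "u i \<bullet> (X *v x) = 0" if "i \<in> I" for i
      using nx(2)[OF that] uv(2)[OF that] by (simp flip: dot_lmul_matrix)
    then have "(X *v x) /\<^sub>R norm (X *v x) \<in> T" using False by (auto simp: T_def)
    from max[OF x this] show ?thesis using False by (simp add: dot_square_norm power2_eq_square field_simps)
  qed (use c0 in simp)
  have norm_le': "norm (y v* X) \<le> c"
  proof (cases "y v* X = 0")
    case False
    have "v i \<bullet> (y v* X) = 0" if "i \<in> I" for i
      using ny(2)[OF that] uv(1)[OF that] by (simp add: inner_commute[of "v i"] dot_lmul_matrix inner_commute[of y])
    then have "(y v* X) /\<^sub>R norm (y v* X) \<in> S" using False by (auto simp: S_def)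
    from max[OF this y] show ?thesis using False
      by (simp flip: dot_lmul_matrix add: dot_square_norm power2_eq_square field_simps)
  qed (use c0 in simp)
  \<comment> \<open>Equality in Cauchy-Schwarz: \<open>|a - c b|^2 = |a|^2 - c^2 \<le> 0\<close>.
    The dimension is generic because the fact is applied once on each side of
    \<open>X\<close>.\<close>
  have eqI: "a = c *\<^sub>R b" if "b \<bullet> b = 1" "b \<bullet> a = c" "norm a \<le> c" for a b :: "real ^ 'l"
  proof -
    have "a \<bullet> a \<le> c\<^sup>2" using that(3) by (simp add: dot_square_norm power_mono)
    then have "(a - c *\<^sub>R b) \<bullet> (a - c *\<^sub>R b) \<le> 0"
      using that(1,2) by (simp add: inner_diff inner_commute power2_eq_square)
    then have "(a - c *\<^sub>R b) \<bullet> (a - c *\<^sub>R b) = 0" by (intro antisym) auto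
    then show ?thesis by simp
  qed
  have Xx: "X *v x = c *\<^sub>R y" using ny(1) norm_le by (intro eqI) (simp_all add: c_def)
  have "x \<bullet> (y v* X) = c" by (metis c_def dot_lmul_matrix inner_commute)
  then have yX: "y v* X = c *\<^sub>R x" using nx(1) norm_le' by (intro eqI)
  show ?case
    by (rule exI[of _ "u(k := y)"], rule exI[of _ "v(k := x)"], rule exI[of _ "s(k := c)"])
      (use uv orth nx ny Xx yX c0 insert.hyps(2) in \<open>auto simp: inner_commute\<close>)
qed

text \<open>The index types have equal size but differ, so \<open>V\<close> is not literally a
  square matrix. As an isometry it is injective, hence onto by dimension, and
  \<open>V ** transpose V\<close> fixes every vector of its range.\<close>

lemma orthonormal_columns_square:
  fixes V :: "real ^ 'q ^ 'n"
  assumes V: "transpose V ** V = mat 1" and "CARD('q) = CARD('n)"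
  shows "V ** transpose V = mat 1"
proof -
  have inj: "inj ((*v) V)"
  proof (rule injI)
    fix x y assume "V *v x = V *v y"
    then have "V *v (x - y) = 0" by (simp add: matrix_vector_mult_diff_distrib)
    then have "norm (x - y) = 0" using norm_orthonormal_columns[OF V, of "x - y"] by simp
    then show "x = y" by simp
  qed
  have "dim (range ((*v) V)) = DIM(real ^ 'n)"
    using dim_image_eq[of "(*v) V" UNIV] inj assms(2) by (simp add: inj_on_subset)
  then have "range ((*v) V) = UNIV"
    by (metis dim_eq_full matrix_vector_mul_linear span_eq_iff linear_subspace_image subspace_UNIV)
  then have "V *v (transpose V *v x) = x" for x
    using V by (metis matrix_vector_mul_assoc matrix_vector_mul_lid rangeE UNIV_I)
  then show ?thesis
    by (metis matrix_eq matrix_vector_mul_assoc matrix_vector_mul_lid)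
qed

lemma Diag_mult_matrix: "Diag s ** M = (\<chi> i j. s $ i * M $ i $ j)"
  by (simp add: vec_eq_iff matrix_matrix_mult_def Diag_def if_distrib[of "\<lambda>x. x * _"] cong: if_cong)

lemma ex_svd:
  fixes X :: "real ^ 'n ^ 'm"
  assumes "CARD('q::{finite,linorder}) = min CARD('m) CARD('n)"
  shows "\<exists>U (s :: real ^ 'q::{finite,linorder}) V. is_svd X U s V"
proof -
  obtain u v and s :: "'q::{finite,linorder} \<Rightarrow> real" where "(\<forall>i. X *v v i = s i *\<^sub>R u i \<and> u i v* X = s i *\<^sub>R v i \<and> 0 \<le> s i) \<and>
    (\<forall>i j. u i \<bullet> u j = (if i = j then 1 else 0) \<and> v i \<bullet> v j = (if i = j then 1 else 0))"
    using ex_singular_triples[of "UNIV :: 'q::{finite,linorder} set" X] assms by auto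
  then have
    uv: "\<And>i. X *v v i = s i *\<^sub>R u i" "\<And>i. u i v* X = s i *\<^sub>R v i" "\<And>i. 0 \<le> s i"
    and orth: "\<And>i j. u i \<bullet> u j = (if i = j then 1 else 0)" "\<And>i j. v i \<bullet> v j = (if i = j then 1 else 0)"
    by blast+
  define U :: "real ^ 'q::{finite,linorder} ^ 'm" where "U = (\<chi> a k. u k $ a)"
  define V :: "real ^ 'q::{finite,linorder} ^ 'n" where "V = (\<chi> b k. v k $ b)"
  have U: "transpose U ** U = mat 1" and V: "transpose V ** V = mat 1"
    using orth by (simp_all add: vec_eq_iff matrix_matrix_mult_def transpose_def mat_def U_def V_def inner_vec_def)
  have XV: "X ** V = U ** Diag (\<chi> k. s k)"
    using uv(1) by (simp add: vec_eq_iff matrix_matrix_mult_def matrix_vector_mult_def U_def V_def Diag_def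
        if_distrib mult.commute cong: if_cong)
  have UX: "transpose U ** X = Diag (\<chi> k. s k) ** transpose V"
    using uv(2) by (simp add: vec_eq_iff matrix_matrix_mult_def[of _ X] vector_matrix_mult_def U_def V_def Diag_mult_matrix
        transpose_def mult.commute)
  \<comment> \<open>Since \<open>'q\<close> has the size of the smaller dimension, \<open>V\<close>
    or \<open>U\<close> is square orthogonal; the identity is inserted on that side, and
    \<open>XV\<close> or \<open>UX\<close> finishes.\<close>
  have X: "X = U ** Diag (\<chi> k. s k) ** transpose V"
  proof (cases "CARD('q) = CARD('n)")
    case True
    then have "X = X ** (V ** transpose V)" using orthonormal_columns_square[OF V] by simp
    then show ?thesis by (simp add: matrix_mul_assoc XV)
  next
    case False
    then have "CARD('q) = CARD('m)" using assms by linarith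
    then have "X = (U ** transpose U) ** X" using orthonormal_columns_square[OF U] by simp
    then show ?thesis by (simp add: UX flip: matrix_mul_assoc)
  qed
  obtain \<pi> :: "'q::{finite,linorder} \<Rightarrow> 'q" where \<pi>: "bij \<pi>" "antimono (($) (\<chi> i. (\<chi> k. s k) $ \<pi> i))"
    using ex_decreasing_permutation[of "\<chi> k. s k"] by blast
  have "(\<chi> k. s k) \<in> nonneg_orthant" using uv(3) by (simp add: nonneg_orthant_def)
  from is_svd_sorted[OF U V this \<pi>] show ?thesis unfolding X[symmetric] by blast
qed

section \<open>Spectral theorem and characteristic polynomial\<close>

lemma eigendecomposition_shift:
  assumes "U ** transpose U = mat 1"
  shows "U ** Diag g ** transpose U + c *\<^sub>R mat 1 = U ** Diag (\<chi> i. g $ i + c) ** transpose U"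
proof -
  have "(\<Sum>k\<in>UNIV. U $ a $ k * U $ b $ k) = mat 1 $ a $ b" for a b
    using assms by (simp add: matrix_matrix_mult_def transpose_def flip: assms)
  then show ?thesis
    by (simp add: vec_eq_iff svd_entry distrib_left distrib_right sum.distrib mult_ac flip: sum_distrib_left)
qed

text \<open>
  If \<open>X + c I\<close> is positive definite with singular pair \<open>(u, v)\<close> for the value \<open>s \<ge> 0\<close>, then
  \<open>u - v\<close> would be an eigenvector for \<open>- s\<close>; so \<open>u = v\<close> and the decomposition is spectral.
\<close>

lemma ex_eigendecomposition:
  fixes X :: "real ^ 'n::{finite,linorder} ^ 'n::{finite,linorder}"
  assumes sym: "transpose X = X"
  shows "\<exists>U g. is_eigendecomposition X U g"
proof -
  define c where "c = onorm ((*v) X) + 1"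
  define Z where "Z = X + c *\<^sub>R mat 1"
  have Zx: "Z *v x = X *v x + c *\<^sub>R x" for x
    by (simp add: Z_def matrix_vector_mult_add_rdistrib scaleR_matrix_vector_assoc[symmetric])
  have pos: "0 < x \<bullet> (Z *v x)" if "x \<noteq> 0" for x
  proof -
    have "- (x \<bullet> (X *v x)) \<le> norm x * norm (X *v x)"
      using Cauchy_Schwarz_ineq2[of x "X *v x"] by linarith
    also have "\<dots> \<le> norm x * (onorm ((*v) X) * norm x)"
      by (intro mult_left_mono onorm) (auto simp: matrix_vector_mul_bounded_linear)
    also have "\<dots> < c * (x \<bullet> x)"
      using that by (simp add: c_def dot_square_norm power2_eq_square algebra_simps)
    finally show ?thesis by (simp add: Zx inner_add)
  qed
  have symZ: "transpose Z = Z"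
    using sym by (simp add: Z_def vec_eq_iff transpose_def mat_def)
  obtain U s V where svd: "is_svd Z U (s :: real ^ 'n::{finite,linorder}) V"
    using ex_svd[of Z] by auto
  then have U: "transpose U ** U = mat 1" and V: "transpose V ** V = mat 1" and s: "antimono (($) s)" "\<And>i. 0 \<le> s $ i"
    and Z: "Z = U ** Diag s ** transpose V"
    by (auto simp: is_svd_def nonneg_orthant_def)
  have ZV: "Z ** V = U ** Diag s"
    by (simp add: Z V flip: matrix_mul_assoc)
  \<comment> \<open>Transposing a symmetric matrix exchanges the roles of the left and right
    singular vectors.\<close>
  have "Z = V ** Diag s ** transpose U"
  proof -
    have "transpose (Diag s) = Diag s" by (auto simp: vec_eq_iff transpose_def Diag_def)
    then show ?thesis using symZ by (simp add: Z matrix_transpose_mul matrix_mul_assoc)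
  qed
  then have ZU: "Z ** U = V ** Diag s"
    by (simp add: U flip: matrix_mul_assoc)
  have eig: "Z *v (U *v axis i 1 - V *v axis i 1) = - s $ i *\<^sub>R (U *v axis i 1 - V *v axis i 1)" for i
  proof -
    have D: "Diag s *v axis i 1 = s $ i *\<^sub>R axis i 1"
      by (simp add: Diag_mult_vec vec_eq_iff axis_def)
    show ?thesis
      by (simp add: matrix_vector_mult_diff_distrib matrix_vector_mul_assoc ZU ZV)
        (simp add: D matrix_vector_mult_scaleR algebra_simps flip: matrix_vector_mul_assoc)
  qed
  have "x = 0" if "x = U *v axis i 1 - V *v axis i 1" for x i
  proof (rule ccontr)
    assume "x \<noteq> 0"
    from pos[OF this] that eig[of i] have "0 < - s $ i * (x \<bullet> x)" by simp
    moreover have "0 \<le> s $ i * (x \<bullet> x)" using s(2) by simp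
    ultimately show False by linarith
  qed
  then have "U *v axis i 1 = V *v axis i 1" for i by simp
  then have "U = V"
    by (simp add: vec_eq_iff matrix_vector_mult_basis column_def)
  have UU: "U ** transpose U = mat 1" using U matrix_left_right_inverse by blast
  have "X = Z + (- c) *\<^sub>R mat 1" by (simp add: Z_def)
  then have "X = U ** Diag (\<chi> i. s $ i + - c) ** transpose U"
    using eigendecomposition_shift[OF UU, of s "- c"] Z \<open>U = V\<close> by simp
  moreover have "antimono (($) (\<chi> i. s $ i + - c))" using s(1) by (simp add: monotone_def)
  ultimately show ?thesis
    using U UU by (auto simp: is_eigendecomposition_def orthogonal_matrix_def)
qed

text \<open>The conjugation is carried out over the polynomial ring, into which \<open>?C\<close>
  embeds real matrices multiplicatively. The scalar matrix of the indeterminate commutes with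
  everything, so the whole characteristic matrix is conjugated, and the determinants of
  \<open>U\<close> and its transpose cancel.\<close>

lemma charpoly_orthogonal_conjugate:
  fixes U :: "real ^ 'n ^ 'n"
  assumes "transpose U ** U = mat 1"
  shows "charpoly (U ** Diag g ** transpose U) = (\<Prod>i\<in>UNIV. [:- (g $ i), 1:])"
proof -
  let ?C = "map_matrix (\<lambda>a :: real. [:a:]) :: real ^ 'n ^ 'n \<Rightarrow> real poly ^ 'n ^ 'n"
  have sum_C: "(\<Sum>k\<in>A. [:f k:]) = [:\<Sum>k\<in>A. f k:]" for f :: "'n \<Rightarrow> real" and A
    by (induction A rule: infinite_finite_induct) simp_all
  have C_mult: "?C (A ** B) = ?C A ** ?C B" for A B :: "real ^ 'n ^ 'n"
    by (simp add: vec_eq_iff matrix_matrix_mult_def sum_C mult.commute)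
  have C_1: "?C (mat 1) = mat 1" by (simp add: vec_eq_iff mat_def)
  have UU: "U ** transpose U = mat 1" using assms matrix_left_right_inverse by blast
  have comm: "A ** mat [:0, 1:] = mat [:0, 1:] ** A" for A :: "real poly ^ 'n ^ 'n"
  proof -
    have "mat c ** A = (\<chi> i j. c * A $ i $ j)" for c
      by (simp add: vec_eq_iff matrix_matrix_mult_def mat_def if_distrib[of "\<lambda>x. x * _"] cong: if_cong)
    moreover have "A ** mat c = (\<chi> i j. A $ i $ j * c)" for c
      by (simp add: vec_eq_iff matrix_matrix_mult_def mat_def if_distrib cong: if_cong)
    ultimately show ?thesis by (simp add: mult.commute)
  qed
  have sub: "A ** (B - C) ** D = A ** B ** D - A ** C ** D" for A B C D :: "real poly ^ 'n ^ 'n"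
    by (simp add: vec_eq_iff matrix_matrix_mult_def left_diff_distrib right_diff_distrib sum_subtractf)
  have "mat [:0, 1:] = mat [:0, 1:] ** (?C U ** ?C (transpose U))"
    by (simp add: UU C_1 flip: C_mult)
  also have "\<dots> = ?C U ** mat [:0, 1:] ** ?C (transpose U)"
    by (simp only: comm matrix_mul_assoc)
  finally have m: "mat [:0, 1:] = \<dots>" .
  have "mat [:0, 1:] - ?C (U ** Diag g ** transpose U)
      = ?C U ** mat [:0, 1:] ** ?C (transpose U) - ?C U ** ?C (Diag g) ** ?C (transpose U)"
    by (subst m) (simp add: C_mult)
  also have "\<dots> = ?C U ** (mat [:0, 1:] - ?C (Diag g)) ** ?C (transpose U)"
    by (rule sub[symmetric])
  finally have "charpoly (U ** Diag g ** transpose U)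
      = det (?C U) * det (mat [:0, 1:] - ?C (Diag g)) * det (?C (transpose U))"
    by (simp add: charpoly_def det_mul)
  also have "\<dots> = det (mat [:0, 1:] - ?C (Diag g)) * det (?C (U ** transpose U))"
    by (simp add: C_mult det_mul)
  also have "\<dots> = det (mat [:0, 1:] - ?C (Diag g))" by (simp add: UU C_1)
  also have "\<dots> = (\<Prod>i\<in>UNIV. [:- (g $ i), 1:])"
    by (subst det_diagonal) (auto simp: mat_def Diag_def)
  finally show ?thesis .
qed

lemma eigenvalues_eqI:
  assumes "antimono (($) g)" "charpoly X = (\<Prod>i\<in>UNIV. [:- (g $ i), 1:])"
  shows "eigenvalues X = (g :: real ^ 'n::{finite,linorder})"
  unfolding eigenvalues_def
proof (rule the_equality)
  fix l :: "real ^ 'n::{finite,linorder}" assume l: "antimono (($) l) \<and> charpoly X = (\<Prod>i\<in>UNIV. [:- (l $ i), 1:])"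
  have "\<forall>i\<in>UNIV. l $ i = g $ i"
  proof (rule decreasing_eq_if_prod_linear_factors_eq)
    show "(\<Prod>i\<in>UNIV. [:- (l $ i), 1:]) = (\<Prod>i\<in>UNIV. [:- (g $ i), 1:])"
      using l assms(2) by argo
  qed (use l assms(1) in \<open>auto dest: antimonoD\<close>)
  then show "l = g" by (simp add: vec_eq_iff)
qed (use assms in simp)

lemma eigenvalues_if_eigendecomposition:
  assumes "is_eigendecomposition X U g"
  shows "eigenvalues X = g"
  using assms charpoly_orthogonal_conjugate[of U g]
  by (intro eigenvalues_eqI) (auto simp: is_eigendecomposition_def orthogonal_matrix_def)

section \<open>Padding, truncation and rank\<close>

lemma position_less: "i < j \<Longrightarrow> position i < position j"
  unfolding position_def by (intro psubset_card_mono) auto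

lemma inj_position: "inj position"
  using position_less by (metis injI less_irrefl_nat neqE)

lemma position_less_card: "position (i :: 'n::{finite,linorder}) < CARD('n)"
  unfolding position_def by (intro psubset_card_mono) auto

lemma at_position_position [simp]: "at_position (position i) = i"
  unfolding at_position_def using inj_position by (auto dest: injD)

lemma position_at_position:
  assumes "m < CARD('n::{finite,linorder})"
  shows "position (at_position m :: 'n) = m"
proof -
  have "range (position :: 'n \<Rightarrow> nat) = {..<CARD('n)}"
    using position_less_card by (intro card_subset_eq) (auto simp: card_image inj_position)
  then obtain i :: 'n where "m = position i" using assms by blast
  then show ?thesis by simp
qed

lemma position_at_position_position:
  assumes "CARD('r::{finite,linorder}) \<le> CARD('q::{finite,linorder})"
  shows "position (at_position (position (i :: 'r)) :: 'q) = position i"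
  using position_less_card[of i] assms by (intro position_at_position) simp

text \<open>The bridge between sums over the index types \<open>'q\<close> and \<open>'r\<close>, on
  which the isometry \<open>pad_zeros\<close> and the formula for \<open>low_rank_matrix\<close>
  rest.\<close>

lemma sum_first_positions:
  fixes h :: "'q::{finite,linorder} \<Rightarrow> 'a::comm_monoid_add"
  assumes "CARD('r::{finite,linorder}) \<le> CARD('q)"
  shows "(\<Sum>k\<in>UNIV. if position k < CARD('r) then h k else 0)
    = (\<Sum>i\<in>(UNIV :: 'r set). h (at_position (position i)))"
proof -
  have "(\<Sum>k\<in>UNIV. if position k < CARD('r) then h k else 0) = sum h {k. position k < CARD('r)}"
    using sum.inter_filter[of UNIV h "\<lambda>k. position k < CARD('r)"] by simp
  also have "\<dots> = (\<Sum>i\<in>(UNIV :: 'r set). h (at_position (position i)))"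
    by (rule sum.reindex_bij_witness[where j = "\<lambda>k. at_position (position k)" and i = "\<lambda>i. at_position (position i)"])
      (simp_all add: position_at_position position_at_position_position[OF assms] position_less_card)
  finally show ?thesis .
qed

lemma first_entries_pad_zeros:
  fixes u :: "real ^ 'r::{finite,linorder}"
  assumes "CARD('r) \<le> CARD('q::{finite,linorder})"
  shows "first_entries (pad_zeros u :: real ^ 'q::{finite,linorder}) = u"
  by (simp add: vec_eq_iff first_entries_def pad_zeros_def position_at_position_position[OF assms] position_less_card)

lemma pad_zeros_first_entries:
  fixes g :: "real ^ 'q::{finite,linorder}"
  assumes "\<And>k. CARD('r::{finite,linorder}) \<le> position k \<Longrightarrow> g $ k = 0"
  shows "pad_zeros (first_entries g :: real ^ 'r::{finite,linorder}) = g"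
  using assms by (auto simp: vec_eq_iff first_entries_def pad_zeros_def position_at_position not_less)

lemma inner_pad_zeros:
  fixes u :: "real ^ 'r::{finite,linorder}" and x :: "real ^ 'q::{finite,linorder}"
  assumes "CARD('r) \<le> CARD('q)"
  shows "pad_zeros u \<bullet> x = u \<bullet> first_entries x"
  using sum_first_positions[OF assms, of "\<lambda>k. u $ at_position (position k) * x $ k"]
  by (simp add: inner_vec_def pad_zeros_def first_entries_def position_at_position_position[OF assms]
      if_distrib[of "\<lambda>a. a * _"] cong: if_cong)

lemma norm_pad_zeros:
  fixes u :: "real ^ 'r::{finite,linorder}"
  assumes "CARD('r) \<le> CARD('q::{finite,linorder})"
  shows "norm (pad_zeros u :: real ^ 'q::{finite,linorder}) = norm u"
  by (simp add: norm_eq_sqrt_inner inner_pad_zeros[OF assms] first_entries_pad_zeros[OF assms])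

lemma pad_zeros_diff: "pad_zeros (u - v) = pad_zeros u - pad_zeros v"
  by (simp add: vec_eq_iff pad_zeros_def)

lemma pad_zeros_nonneg: "u \<in> nonneg_orthant \<Longrightarrow> pad_zeros u \<in> nonneg_orthant"
  by (simp add: pad_zeros_def nonneg_orthant_def)

lemma first_entries_nonneg: "g \<in> nonneg_orthant \<Longrightarrow> first_entries g \<in> nonneg_orthant"
  by (simp add: first_entries_def nonneg_orthant_def)

text \<open>Columns beyond the first \<open>CARD('r)\<close> get weight zero. In this form the
  construction has the same outer factors as \<open>Y\<close>, so \<open>inner_svd_same\<close>
  evaluates its inner product with \<open>Y\<close>.\<close>

lemma low_rank_matrix_eq:
  fixes U :: "real ^ 'q::{finite,linorder} ^ 'm" and V :: "real ^ 'q::{finite,linorder} ^ 'n"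
    and u :: "real ^ 'r::{finite,linorder}"
  assumes "CARD('r) \<le> CARD('q)"
  shows "low_rank_matrix U u V = U ** Diag (pad_zeros u) ** transpose V"
proof -
  have "(\<Sum>k\<in>UNIV. U $ a $ k * pad_zeros u $ k * V $ b $ k)
      = (\<Sum>i\<in>UNIV. U $ a $ at_position (position i) * u $ i * V $ b $ at_position (position i))" for a b
    using sum_first_positions[OF assms, of "\<lambda>k. U $ a $ k * u $ at_position (position k) * V $ b $ k"]
    by (simp add: pad_zeros_def position_at_position_position[OF assms] if_distrib[of "\<lambda>a. _ * a"]
      if_distrib[of "\<lambda>a. a * _"] cong: if_cong)
  then show ?thesis
    by (simp add: vec_eq_iff low_rank_matrix_def svd_entry first_cols_def first_entries_def)
qed

lemma rank_low_rank_matrix: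
  fixes u :: "real ^ 'r::{finite,linorder}"
  shows "rank (low_rank_matrix U u V) \<le> CARD('r)"
proof -
  have "rank (low_rank_matrix U u V) \<le> rank (first_cols U :: real ^ 'r::{finite,linorder} ^ _)"
    unfolding low_rank_matrix_def matrix_mul_assoc[symmetric] by (rule rank_mul_le_left)
  also have "\<dots> \<le> CARD('r)" using rank_bound[of "first_cols U :: real ^ 'r::{finite,linorder} ^ _"] by simp
  finally show ?thesis .
qed

text \<open>If \<open>s $ k\<close> were positive, so would be all earlier entries, and the range of
  \<open>X\<close> would contain the orthonormal columns of \<open>U\<close> up to and including
  \<open>k\<close>. Positions start at 0, so there are \<open>position k + 1\<close> of them, one
  more than the rank allows.\<close>

lemma svd_entry_eq_0:
  fixes s :: "real ^ 'q::{finite,linorder}"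
  assumes svd: "is_svd X U s V" and k: "rank X \<le> position k"
  shows "s $ k = 0"
proof (rule ccontr)
  assume "s $ k \<noteq> 0"
  have U: "transpose U ** U = mat 1" and V: "transpose V ** V = mat 1" and X: "X = U ** Diag s ** transpose V"
    and nonneg: "\<And>j. 0 \<le> s $ j" and mono: "\<And>i j. i \<le> j \<Longrightarrow> s $ j \<le> s $ i"
    using svd by (auto simp: is_svd_def nonneg_orthant_def dest: antimonoD)
  have pos: "0 < s $ j" if "j \<le> k" for j
    using mono[OF that] nonneg[of k] \<open>s $ k \<noteq> 0\<close> by linarith
  have orth: "column i U \<bullet> column j U = (if i = j then 1 else 0)" for i j
  proof -
    have "column i U \<bullet> column j U = (transpose U ** U) $ i $ j"
      by (simp add: inner_vec_def column_def matrix_matrix_mult_def transpose_def)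
    then show ?thesis by (simp add: U mat_def)
  qed
  let ?B = "(\<lambda>j. column j U) ` {..k}"
  have "inj_on (\<lambda>j. column j U) {..k}"
    using orth by (intro inj_onI) (metis zero_neq_one)
  then have "card ?B = card {..k}" by (rule card_image)
  moreover have "{..k} = insert k {..<k}" by auto
  ultimately have card: "card ?B = Suc (position k)" by (simp add: position_def)
  have "pairwise orthogonal ?B"
    using orth by (auto simp: pairwise_def orthogonal_def)
  moreover have "column j U \<noteq> 0" for j using orth[of j j] by auto
  then have "0 \<notin> ?B" by (metis imageE)
  ultimately have "independent ?B" by (rule pairwise_orthogonal_independent)
  moreover have "?B \<subseteq> range ((*v) X)"
  proof clarify
    fix j assume "j \<le> k"
    have "X ** V = U ** Diag s" by (simp add: X V flip: matrix_mul_assoc)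
    then have "X *v (V *v axis j 1) = U *v (Diag s *v axis j 1)"
      by (simp add: matrix_vector_mul_assoc)
    also have "Diag s *v axis j 1 = s $ j *\<^sub>R axis j 1"
      by (simp add: Diag_mult_vec vec_eq_iff axis_def)
    finally have "X *v (V *v axis j 1) = s $ j *\<^sub>R column j U"
      by (simp add: matrix_vector_mult_scaleR matrix_vector_mult_basis)
    then have "column j U = X *v ((1 / s $ j) *\<^sub>R (V *v axis j 1))"
      using pos[OF \<open>j \<le> k\<close>] by (simp add: matrix_vector_mult_scaleR)
    then show "column j U \<in> range ((*v) X)" by blast
  qed
  ultimately have "card ?B \<le> rank X"
    unfolding rank_dim_range by (intro independent_card_le_dim)
  then show False using card k by simp
qed

section \<open>Existence of reduced minimizers\<close>

text \<open>
  The hyperplane separating \<open>(x\<^sub>0, \<phi>(x\<^sub>0) - 1)\<close> from the epigraph is an affine minorant of \<open>\<phi>\<close>, so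
  the sublevel sets of \<open>(x, t) \<mapsto> \<lambda> |x - a|\<^sup>2 + t\<close> on the epigraph are compact.
\<close>

lemma ex_prox_minimizer:
  fixes \<phi> :: "'a::euclidean_space \<Rightarrow> ereal"
  assumes cc: "closed_convex_fun S \<phi>" and ninf: "\<And>x. x \<in> S \<Longrightarrow> \<phi> x \<noteq> -\<infinity>"
    and C: "closed C" "C \<subseteq> S" and x0: "x0 \<in> C" "\<phi> x0 < \<infinity>" and lam: "0 < lam"
  obtains x where "x \<in> C" "\<phi> x < \<infinity>"
    "\<And>y. y \<in> C \<Longrightarrow> ereal (lam * (norm (x - a))\<^sup>2) + \<phi> x \<le> ereal (lam * (norm (y - a))\<^sup>2) + \<phi> y"
proof -
  define E where "E = ereal_epigraph S \<phi>"
  define h where "h p = lam * (norm (fst p - a))\<^sup>2 + snd p" for p :: "'a \<times> real"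
  obtain t0 where t0: "\<phi> x0 = ereal t0"
    using x0 C(2) ninf by (cases "\<phi> x0") auto
  have "(x0, t0) \<in> E" "(x0, t0 - 1) \<notin> E"
    using x0 C(2) by (auto simp: E_def ereal_epigraph_def t0)
  have E: "closed E" "convex E" using cc by (auto simp: closed_convex_fun_def E_def)
  then obtain p \<beta> where "p \<bullet> (x0, t0 - 1) < \<beta>" and sep: "\<And>z. z \<in> E \<Longrightarrow> \<beta> < p \<bullet> z"
    using separating_hyperplane_closed_point[OF _ _ \<open>(x0, t0 - 1) \<notin> E\<close>] by blast
  define b s where "b = fst p" and "s = snd p"
  have lt: "b \<bullet> x0 + s * (t0 - 1) < \<beta>" and above: "\<And>x t. (x, t) \<in> E \<Longrightarrow> \<beta> < b \<bullet> x + s * t"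
    using \<open>p \<bullet> (x0, t0 - 1) < \<beta>\<close> sep by (force simp: b_def s_def inner_prod_def)+
  \<comment> \<open>The hyperplane is not vertical, since it separates two points above the same
    \<open>x0\<close>.\<close>
  have "0 < s" using lt above[OF \<open>(x0, t0) \<in> E\<close>] by (simp add: algebra_simps)
  \<comment> \<open>Dividing the separation by \<open>s\<close> gives
    \<open>L - B * norm (x - a) \<le> t\<close> on the epigraph. If moreover
    \<open>h (x, t) \<le> h (x0, t0)\<close> and \<open>norm (x - a) > 1\<close>, then \<open>lam *
    norm (x - a)^2 \<le> K + B * norm (x - a) \<le> (K + B) * norm (x - a)\<close>; the summand 1 in
    \<open>M\<close> covers the remaining case.\<close>
  define B where "B = norm b / s"
  define L where "L = (\<beta> - b \<bullet> a) / s"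
  define K where "K = \<bar>h (x0, t0) - L\<bar>"
  define M where "M = 1 + (K + B) / lam"
  have B0: "0 \<le> B" using \<open>0 < s\<close> by (simp add: B_def)
  have K0: "0 \<le> K" by (simp add: K_def)
  have minorant: "L - B * norm (x - a) \<le> t" if "(x, t) \<in> E" for x t
  proof -
    have "\<beta> - b \<bullet> a - b \<bullet> (x - a) < t * s" using above[OF that] by (simp add: inner_diff algebra_simps)
    moreover have "b \<bullet> (x - a) \<le> norm b * norm (x - a)" by (rule norm_cauchy_schwarz)
    ultimately have "\<beta> - b \<bullet> a - norm b * norm (x - a) < t * s" by linarith
    then have "(\<beta> - b \<bullet> a - norm b * norm (x - a)) / s < t"
      using \<open>0 < s\<close> by (simp add: pos_divide_less_eq)
    then show ?thesis by (simp add: L_def B_def diff_divide_distrib)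
  qed
  define D where "D = E \<inter> C \<times> UNIV \<inter> {p. h p \<le> h (x0, t0)}"
  have h_cont: "continuous_on A h" for A
    unfolding h_def by (intro continuous_intros)
  have "D \<subseteq> cball a M \<times> {L - B * M .. h (x0, t0)}"
  proof (rule subrelI)
    fix x t assume "(x, t) \<in> D"
    then have xt: "(x, t) \<in> E" and le: "lam * (norm (x - a))\<^sup>2 + t \<le> h (x0, t0)"
      by (auto simp: D_def h_def)
    have "norm (x - a) \<le> M"
    proof (cases "norm (x - a) \<le> 1")
      case True
      then show ?thesis using B0 K0 lam unfolding M_def
        by (smt (verit) divide_nonneg_pos)
    next
      case False
      have "lam * (norm (x - a))\<^sup>2 \<le> K + B * norm (x - a)"
        using le minorant[OF xt] unfolding K_def by linarith
      also have "\<dots> \<le> K * norm (x - a) + B * norm (x - a)"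
        using False K0 mult_left_mono[of 1 "norm (x - a)" K] by simp
      finally have "(lam * norm (x - a)) * norm (x - a) \<le> (K + B) * norm (x - a)"
        by (simp add: power2_eq_square algebra_simps)
      then have "lam * norm (x - a) \<le> K + B"
        using False by (smt (verit) mult_right_le_imp_le)
      then have "norm (x - a) \<le> (K + B) / lam" using lam by (simp add: field_simps)
      then show ?thesis by (simp add: M_def)
    qed
    moreover from this have "B * norm (x - a) \<le> B * M" using B0 by (rule mult_left_mono)
    then have "L - B * M \<le> t" using minorant[OF xt] by linarith
    moreover have "t \<le> h (x0, t0)" using le lam by (smt (verit) mult_nonneg_nonneg zero_le_power2)
    ultimately show "(x, t) \<in> cball a M \<times> {L - B * M .. h (x0, t0)}"
      by (simp add: dist_norm norm_minus_commute)
  qed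
  moreover have "closed D"
    unfolding D_def using E(1) C(1)
    by (intro closed_Int closed_Times closed_UNIV closed_Collect_le h_cont continuous_on_const)
  ultimately have "compact D"
    by (metis compact_Icc compact_Int_closed compact_Times compact_cball inf.absorb_iff2)
  moreover have "(x0, t0) \<in> D"
    using \<open>(x0, t0) \<in> E\<close> x0(1) by (simp add: D_def)
  ultimately obtain q where q: "q \<in> D" "\<And>z. z \<in> D \<Longrightarrow> h q \<le> h z"
    using continuous_attains_inf[OF _ _ h_cont, of D] by blast
  obtain x t where xt: "q = (x, t)" by (cases q)
  have x: "x \<in> C" "\<phi> x \<le> ereal t"
    using q(1) by (auto simp: xt D_def E_def ereal_epigraph_def)
  show thesis
  proof (rule that[of x])
    show "\<phi> x < \<infinity>" using x(2) by auto
    fix y assume y: "y \<in> C"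
    show "ereal (lam * (norm (x - a))\<^sup>2) + \<phi> x \<le> ereal (lam * (norm (y - a))\<^sup>2) + \<phi> y"
    proof (cases "\<phi> y")
      case (real ty)
      have "(y, ty) \<in> E" using y C(2) by (auto simp: E_def ereal_epigraph_def real)
      \<comment> \<open>A point outside the sublevel set \<open>D\<close> is already beaten by
        \<open>(x0, t0)\<close>.\<close>
      then have "h q \<le> h (y, ty)"
        using q y \<open>(x0, t0) \<in> D\<close> by (cases "h (y, ty) \<le> h (x0, t0)") (force simp: D_def)+
      then have "ereal (lam * (norm (x - a))\<^sup>2) + ereal t \<le> ereal (lam * (norm (y - a))\<^sup>2) + \<phi> y"
        by (simp add: h_def xt real)
      then show ?thesis using add_left_mono[OF x(2)] order_trans by blast
    next
      case MInf
      then show ?thesis using ninf y C(2) by blast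
    qed simp
  qed (fact x(1))
qed

text \<open>On the orthant \<open>pad_zeros\<close> is an isometry onto the closed set
  \<open>C\<close>, so the reduced problem is a proximal problem for \<open>\<rho>\<close> itself
  over \<open>C\<close>. Closedness and convexity are then used on \<open>S\<close>, where they are
  given, with \<open>g\<close> as the point of finite value.\<close>

lemma reduced_minimizers_nonempty:
  fixes \<rho> :: "real ^ 'q::{finite,linorder} \<Rightarrow> ereal"
  assumes r: "CARD('r::{finite,linorder}) \<le> CARD('q)"
    and cc: "closed_convex_fun S \<rho>" and ninf: "\<And>x. x \<in> S \<Longrightarrow> \<rho> x \<noteq> -\<infinity>" and S: "nonneg_orthant \<subseteq> S"
    and g: "g \<in> nonneg_orthant" "\<rho> g < \<infinity>" "\<And>k. CARD('r) \<le> position k \<Longrightarrow> g $ k = 0" and lam: "0 < lam"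
  shows "(reduced_minimizers \<rho> lam s :: (real ^ 'r::{finite,linorder}) set) \<noteq> {}"
proof -
  define C :: "(real ^ 'q::{finite,linorder}) set" where
    "C = (\<Inter>k. {x. 0 \<le> x $ k}) \<inter> (\<Inter>k\<in>{k. CARD('r) \<le> position k}. {x. x $ k = 0})"
  have "closed C" unfolding C_def
    by (intro closed_Int closed_INT ballI closed_Collect_le closed_Collect_eq continuous_intros)
  have C: "x \<in> C \<longleftrightarrow> x \<in> nonneg_orthant \<and> (\<forall>k. CARD('r) \<le> position k \<longrightarrow> x $ k = 0)" for x
    by (auto simp: C_def nonneg_orthant_def)
  \<comment> \<open>The centre is the padded truncation of \<open>s\<close>, not \<open>s\<close>,
    so that distances on \<open>C\<close> equal those of the reduced problem.\<close>
  let ?a = "pad_zeros (first_entries s :: real ^ 'r::{finite,linorder}) :: real ^ 'q::{finite,linorder}"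
  obtain x where x: "x \<in> C" "\<rho> x < \<infinity>"
    "\<And>y. y \<in> C \<Longrightarrow> ereal (lam * (norm (x - ?a))\<^sup>2) + \<rho> x \<le> ereal (lam * (norm (y - ?a))\<^sup>2) + \<rho> y"
    using ex_prox_minimizer[OF cc ninf \<open>closed C\<close> _ _ g(2) lam] S g C by blast
  let ?u = "first_entries x :: real ^ 'r::{finite,linorder}"
  have pad_u: "pad_zeros ?u = x" using x(1) C by (intro pad_zeros_first_entries) blast
  have norm_eq: "norm (pad_zeros v - ?a) = norm (v - first_entries s)" for v :: "real ^ 'r::{finite,linorder}"
    using norm_pad_zeros[OF r] by (metis pad_zeros_diff)
  have "pad_zeros v \<in> C" if "v \<in> nonneg_orthant" for v :: "real ^ 'r::{finite,linorder}"
    using pad_zeros_nonneg[OF that] by (simp add: C pad_zeros_def)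
  then have "ereal (lam * (norm (?u - first_entries s))\<^sup>2) + \<rho> (pad_zeros ?u)
      \<le> ereal (lam * (norm (v - first_entries s))\<^sup>2) + \<rho> (pad_zeros v)" if "v \<in> nonneg_orthant" for v :: "real ^ 'r::{finite,linorder}"
    using x(3)[of "pad_zeros v"] that norm_eq[of v] norm_eq[of ?u] by (simp add: pad_u)
  moreover have "?u \<in> nonneg_orthant" using x(1) C first_entries_nonneg by blast
  ultimately have "?u \<in> reduced_minimizers \<rho> lam s"
    using x(2) by (auto simp: reduced_minimizers_def argmin_set_def is_arg_min_def pad_u not_less)
  then show ?thesis by blast
qed

lemma reduced_minimizersD:
  fixes u v :: "real ^ 'r::{finite,linorder}"
  assumes "u \<in> reduced_minimizers \<rho> lam s"
  shows "u \<in> nonneg_orthant" "\<rho> (pad_zeros u) < \<infinity>"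
    "v \<in> nonneg_orthant \<Longrightarrow> ereal (lam * (norm (u - first_entries s))\<^sup>2) + \<rho> (pad_zeros u)
      \<le> ereal (lam * (norm (v - first_entries s))\<^sup>2) + \<rho> (pad_zeros v)"
  using assms by (auto simp: reduced_minimizers_def argmin_set_def is_arg_min_def not_less)

text \<open>
  Here \<open>X\<close> stands for a competitor with spectrum \<open>g\<close> and \<open>Z\<close> for the constructed matrix: both
  squared distances to \<open>Y\<close> exceed those of the reduced vectors by \<open>|Y|\<^sup>2 - |s\<^sub>1\<^sub>:\<^sub>r|\<^sup>2\<close>, with
  \<open>\<ge>\<close> for \<open>X\<close> by the trace inequality.
\<close>

lemma reduced_minimizer_prox_le:
  fixes X Y Z :: "'a::real_inner" and g s :: "real ^ 'q::{finite,linorder}" and u :: "real ^ 'r::{finite,linorder}"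
  assumes r: "CARD('r) \<le> CARD('q)" and lam: "0 < lam" and u: "u \<in> reduced_minimizers \<rho> lam s"
    and g: "g \<in> nonneg_orthant" "\<And>k. CARD('r) \<le> position k \<Longrightarrow> g $ k = 0"
    and X: "norm X = norm g" "X \<bullet> Y \<le> g \<bullet> s"
    and Z: "norm Z = norm (pad_zeros u :: real ^ 'q::{finite,linorder})" "Z \<bullet> Y = pad_zeros u \<bullet> s"
  shows "ereal (lam * (norm (Z - Y))\<^sup>2) + \<rho> (pad_zeros u) \<le> ereal (lam * (norm (X - Y))\<^sup>2) + \<rho> g"
proof -
  let ?v = "first_entries g :: real ^ 'r::{finite,linorder}"
  let ?s = "first_entries s :: real ^ 'r::{finite,linorder}"
  define K where "K = (norm Y)\<^sup>2 - (norm ?s)\<^sup>2"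
  have pad_v: "pad_zeros ?v = g" using g(2) by (rule pad_zeros_first_entries)
  have sq: "(norm (x - y))\<^sup>2 = (norm x)\<^sup>2 + (norm y)\<^sup>2 - 2 * (x \<bullet> y)" for x y :: "'b::real_inner"
    by (simp add: power2_norm_eq_inner inner_diff inner_commute)
  have Z_eq: "(norm (Z - Y))\<^sup>2 = (norm (u - ?s))\<^sup>2 + K"
    using Z by (simp add: sq K_def norm_pad_zeros[OF r] inner_pad_zeros[OF r])
  have "norm ?v = norm g" "?v \<bullet> ?s = g \<bullet> s"
    using norm_pad_zeros[OF r, of ?v] inner_pad_zeros[OF r, of ?v s] by (simp_all add: pad_v)
  then have X_ge: "(norm (?v - ?s))\<^sup>2 + K \<le> (norm (X - Y))\<^sup>2"
    using X by (simp add: sq K_def)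
  have "ereal (lam * (norm (Z - Y))\<^sup>2) + \<rho> (pad_zeros u)
      = ereal (lam * K) + (ereal (lam * (norm (u - ?s))\<^sup>2) + \<rho> (pad_zeros u))"
    unfolding Z_eq by (simp add: algebra_simps flip: plus_ereal.simps)
  also have "\<dots> \<le> ereal (lam * K) + (ereal (lam * (norm (?v - ?s))\<^sup>2) + \<rho> g)"
    using reduced_minimizersD(3)[OF u first_entries_nonneg[OF g(1)]] by (intro add_left_mono) (simp add: pad_v)
  also have "\<dots> = ereal (lam * ((norm (?v - ?s))\<^sup>2 + K)) + \<rho> g"
    by (simp add: algebra_simps flip: plus_ereal.simps)
  also have "\<dots> \<le> ereal (lam * (norm (X - Y))\<^sup>2) + \<rho> g"
    using X_ge lam by (intro add_right_mono) (simp add: mult_left_mono)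
  finally show ?thesis .
qed

section \<open>Low-rank minimizers\<close>

lemma is_svd_inner_norm:
  assumes "is_svd Y U s V"
  shows "norm (U ** Diag w ** transpose V) = norm w" "(U ** Diag w ** transpose V) \<bullet> Y = w \<bullet> s"
  using assms norm_svd[of U V w] inner_svd_same[of U V w s] by (auto simp: is_svd_def)

text \<open>Solutions have finite \<open>R\<close> and low rank, so they are among the competitors
  that \<open>A Y lam\<close> beats. For \<open>lam = 0\<close> an oracle only has to return a point
  of the domain, which is the separate assumption \<open>zero\<close>.\<close>

lemma weak_prox_oracleI:
  fixes V :: "(real ^ 'n ^ 'm) set"
  assumes rank: "\<forall>Xs\<in>solutions V f R. rank Xs \<le> r" and zero: "\<forall>Y\<in>V. A Y 0 \<in> dom_on V R"
    and min: "\<And>Y lam. Y \<in> V \<Longrightarrow> 0 < lam \<Longrightarrow> A Y lam \<in> argmin_set (low_rank_dom V R r) (prox_objective R lam Y)"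
  shows "weak_prox_oracle V f R A"
  unfolding weak_prox_oracle_def
proof (intro conjI ballI allI impI)
  fix Y lam assume "Y \<in> V" "0 \<le> (lam :: real)"
  then show "A Y lam \<in> dom_on V R"
    using zero min[of Y lam] by (cases "lam = 0") (auto simp: argmin_set_def is_arg_min_def low_rank_dom_def)
next
  fix Y lam Xs assume Y: "Y \<in> V" and lam: "0 < (lam :: real)" and Xs: "Xs \<in> solutions V f R"
  then have "Xs \<in> low_rank_dom V R r"
    using rank by (auto simp: solutions_def argmin_set_def is_arg_min_def low_rank_dom_def dom_on_def composite_def)
  then show "prox_objective R lam Y (A Y lam) \<le> prox_objective R lam Y Xs"
    using min[OF Y lam] by (auto simp: argmin_set_def is_arg_min_def not_less)
qed

text \<open>Here the existence of solutions enters: it provides the low-rank point at which the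
  reduced problem has finite value.\<close>

lemma ex_solution_low_rank:
  fixes V :: "(real ^ 'n ^ 'm) set"
  assumes "composite_problem V f R" "\<forall>Xs\<in>solutions V f R. rank Xs \<le> r"
  obtains X where "X \<in> low_rank_dom V R r"
  using assms
  by (fastforce simp: composite_problem_def solutions_def argmin_set_def is_arg_min_def low_rank_dom_def
      dom_on_def composite_def)

section \<open>Rectangular setting\<close>

lemma permutation_invariant_singular_values_low_rank:
  fixes U :: "real ^ 'q::{finite,linorder} ^ 'm" and V :: "real ^ 'q::{finite,linorder} ^ 'n"
    and u :: "real ^ 'r::{finite,linorder}"
    and \<rho> :: "real ^ 'q::{finite,linorder} \<Rightarrow> ereal"
  assumes r: "CARD('r) \<le> CARD('q)" and perm: "permutation_invariant nonneg_orthant \<rho>"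
    and svd: "is_svd Y U s V" and u: "u \<in> nonneg_orthant"
  shows "\<rho> (singular_values (low_rank_matrix U u V)) = \<rho> (pad_zeros u)"
proof -
  let ?w = "pad_zeros u :: real ^ 'q::{finite,linorder}"
  obtain \<pi> :: "'q \<Rightarrow> 'q" where \<pi>: "bij \<pi>" "antimono (($) (\<chi> i. ?w $ \<pi> i))"
    using ex_decreasing_permutation[of ?w] by blast
  have w: "?w \<in> nonneg_orthant" using u by (rule pad_zeros_nonneg)
  have "singular_values (low_rank_matrix U u V) = (\<chi> i. ?w $ \<pi> i)"
    using is_svd_sorted[OF _ _ w \<pi>, of U V] svd
    by (intro singular_values_eqI) (auto simp: low_rank_matrix_eq[OF r] is_svd_def)
  then show ?thesis using perm w \<pi>(1) by (simp add: permutation_invariant_def)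
qed

lemma low_rank_matrix_minimizes_rectangular:
  fixes R :: "real ^ 'n ^ 'm \<Rightarrow> ereal" and \<rho> :: "real ^ 'q::{finite,linorder} \<Rightarrow> ereal"
    and u :: "real ^ 'r::{finite,linorder}"
  assumes q: "CARD('q) = min CARD('m) CARD('n)" and r: "CARD('r) \<le> CARD('q)"
    and perm: "permutation_invariant nonneg_orthant \<rho>" and R: "\<And>X. R X = \<rho> (singular_values X)"
    and lam: "0 < lam" and svd: "is_svd Y U s V" and u: "u \<in> reduced_minimizers \<rho> lam s"
  shows "low_rank_matrix U u V \<in> argmin_set (low_rank_dom UNIV R CARD('r)) (prox_objective R lam Y)"
proof -
  let ?Z = "low_rank_matrix U u V"
  note D = reduced_minimizersD[OF u]
  have RZ: "R ?Z = \<rho> (pad_zeros u)"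
    using permutation_invariant_singular_values_low_rank[OF r perm svd D(1)] R by simp
  have le: "prox_objective R lam Y ?Z \<le> prox_objective R lam Y X"
    if X: "X \<in> low_rank_dom UNIV R CARD('r)" for X
  proof -
    obtain W g T where svdX: "is_svd X W (g :: real ^ 'q::{finite,linorder}) T" using ex_svd[OF q] by blast
    have "g $ k = 0" if "CARD('r) \<le> position k" for k
      using svd_entry_eq_0[OF svdX, of k] X that by (simp add: low_rank_dom_def)
    moreover have "R X = \<rho> g" using R singular_values_eqI[OF svdX] by simp
    moreover have "norm X = norm g" "g \<in> nonneg_orthant"
      using svdX norm_svd[of W T g] by (auto simp: is_svd_def)
    ultimately show ?thesis
      unfolding prox_objective_def RZ \<open>R X = \<rho> g\<close>
      using von_neumann_trace[OF svdX svd] is_svd_inner_norm[OF svd, of "pad_zeros u"]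
      by (intro reduced_minimizer_prox_le[OF r lam u]) (simp_all add: low_rank_matrix_eq[OF r])
  qed
  have "?Z \<in> low_rank_dom UNIV R CARD('r)"
    using D(2) RZ by (simp add: low_rank_dom_def dom_on_def rank_low_rank_matrix)
  then show ?thesis
    using le D(2) RZ by (auto simp: argmin_set_def is_arg_min_def not_less prox_objective_def)
qed

lemma reduced_minimizers_nonempty_rectangular:
  fixes R :: "real ^ 'n ^ 'm \<Rightarrow> ereal" and \<rho> :: "real ^ 'q::{finite,linorder} \<Rightarrow> ereal"
  assumes q: "CARD('q) = min CARD('m) CARD('n)" and r: "CARD('r::{finite,linorder}) \<le> CARD('q)"
    and \<rho>: "proper_fun nonneg_orthant \<rho>" "closed_convex_fun nonneg_orthant \<rho>"
    and R: "\<And>X. R X = \<rho> (singular_values X)"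
    and X: "X \<in> low_rank_dom UNIV R CARD('r)" and lam: "0 < lam"
  shows "(reduced_minimizers \<rho> lam s :: (real ^ 'r::{finite,linorder}) set) \<noteq> {}"
proof -
  obtain W g T where svdX: "is_svd X W (g :: real ^ 'q::{finite,linorder}) T" using ex_svd[OF q] by blast
  show ?thesis
  proof (rule reduced_minimizers_nonempty[OF r \<rho>(2) _ order_refl _ _ _ lam])
    show "g \<in> nonneg_orthant" using svdX by (simp add: is_svd_def)
    show "\<rho> g < \<infinity>" using X singular_values_eqI[OF svdX] by (simp add: low_rank_dom_def dom_on_def R)
    show "g $ k = 0" if "CARD('r) \<le> position k" for k
      using svd_entry_eq_0[OF svdX, of k] X that by (simp add: low_rank_dom_def)
  qed (use \<rho>(1) in \<open>auto simp: proper_fun_def\<close>)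
qed

section \<open>Symmetric setting\<close>

lemma is_eigendecomposition_orthogonal:
  assumes "is_eigendecomposition X U g"
  shows "transpose U ** U = mat 1" "U ** transpose U = mat 1"
  using assms by (auto simp: is_eigendecomposition_def orthogonal_matrix_def)

lemma is_svd_if_eigenvalues_nonneg:
  assumes "is_eigendecomposition X U g" "g \<in> nonneg_orthant"
  shows "is_svd X U g U"
  using assms is_eigendecomposition_orthogonal[OF assms(1)]
  by (auto simp: is_svd_def is_eigendecomposition_def)

text \<open>The constant \<open>c = norm s\<close> dominates every \<open>\<bar>s $ i\<bar>\<close>,
  so \<open>Y + c I\<close> has nonnegative eigenvalues and von Neumann's inequality applies to it.
  Both sides exceed the desired ones by \<open>c\<close> times the trace of
  \<open>X\<close>.\<close>

lemma trace_inequality_symmetric: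
  fixes X Y :: "real ^ 'n::{finite,linorder} ^ 'n::{finite,linorder}"
  assumes X: "is_eigendecomposition X W g" "g \<in> nonneg_orthant" and Y: "is_eigendecomposition Y U s"
  shows "X \<bullet> Y \<le> g \<bullet> s"
proof -
  define c where "c = norm s"
  note W = is_eigendecomposition_orthogonal[OF X(1)] and U = is_eigendecomposition_orthogonal[OF Y]
  have s: "antimono (($) s)" and Yeq: "Y = U ** Diag s ** transpose U"
    using Y by (auto simp: is_eigendecomposition_def)
  have Yc: "is_svd (Y + c *\<^sub>R mat 1) U (\<chi> i. s $ i + c) U"
    unfolding is_svd_def
  proof (intro conjI U)
    show "(\<chi> i. s $ i + c) \<in> nonneg_orthant"
      using component_le_norm_cart[of s] by (simp add: nonneg_orthant_def c_def) (smt (verit))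
  qed (use s eigendecomposition_shift[OF U(2), of s c] in \<open>auto simp: Yeq monotone_def\<close>)
  have "Diag (\<chi> i. 1) = (mat 1 :: real ^ 'n::{finite,linorder} ^ 'n::{finite,linorder})" by (simp add: vec_eq_iff Diag_def mat_def)
  \<comment> \<open>Writing the identity with the outer factors of \<open>X\<close> makes its inner
    product with \<open>X\<close>, the trace, equal to the sum of the entries of
    \<open>g\<close>.\<close>
  then have "mat 1 = W ** Diag (\<chi> i. 1) ** transpose W" by (simp add: W)
  then have "X \<bullet> mat 1 = g \<bullet> (\<chi> i. 1)"
    using inner_svd_same[OF W(1) W(1), of g "\<chi> i. 1"] X(1) by (simp add: is_eigendecomposition_def)
  moreover have "X \<bullet> (Y + c *\<^sub>R mat 1) \<le> g \<bullet> (\<chi> i. s $ i + c)"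
    by (rule von_neumann_trace[OF is_svd_if_eigenvalues_nonneg[OF X] Yc])
  moreover have "(\<chi> i. s $ i + c) = s + c *\<^sub>R (\<chi> i. 1)" by (simp add: vec_eq_iff)
  ultimately show ?thesis by (simp add: inner_add_right)
qed

text \<open>Sorting takes place inside the characteristic polynomial: its product of linear factors
  is unchanged by the permutation, and the columns of \<open>U\<close> stay in place.\<close>

lemma permutation_invariant_eigenvalues_low_rank:
  fixes U :: "real ^ 'd::{finite,linorder} ^ 'd::{finite,linorder}" and u :: "real ^ 'r::{finite,linorder}"
    and \<rho> :: "real ^ 'd::{finite,linorder} \<Rightarrow> ereal"
  assumes r: "CARD('r) \<le> CARD('d)" and perm: "permutation_invariant UNIV \<rho>"
    and U: "transpose U ** U = mat 1"
  shows "\<rho> (eigenvalues (low_rank_matrix U u U)) = \<rho> (pad_zeros u)"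
proof -
  let ?w = "pad_zeros u :: real ^ 'd::{finite,linorder}"
  obtain \<pi> :: "'d::{finite,linorder} \<Rightarrow> 'd" where \<pi>: "bij \<pi>" "antimono (($) (\<chi> i. ?w $ \<pi> i))"
    using ex_decreasing_permutation[of ?w] by blast
  have "(\<Prod>i\<in>UNIV. [:- (?w $ \<pi> i), 1:]) = (\<Prod>i\<in>UNIV. [:- (?w $ i), 1:])"
    by (rule prod.reindex_bij_betw[OF \<pi>(1)])
  then have "eigenvalues (low_rank_matrix U u U) = (\<chi> i. ?w $ \<pi> i)"
    using \<pi>(2) charpoly_orthogonal_conjugate[OF U, of ?w]
    by (intro eigenvalues_eqI) (simp_all add: low_rank_matrix_eq[OF r])
  then show ?thesis using perm \<pi>(1) by (simp add: permutation_invariant_def)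
qed

text \<open>Finiteness of \<open>R X\<close> puts the eigenvalues into the domain of
  \<open>\<rho>\<close>, hence into the orthant. The eigendecomposition is then a singular value
  decomposition, and the rank bound makes the tail vanish.\<close>

lemma ex_nonneg_eigendecomposition_low_rank:
  fixes R :: "real ^ 'd::{finite,linorder} ^ 'd::{finite,linorder} \<Rightarrow> ereal"
  assumes dom: "dom_on UNIV \<rho> \<subseteq> nonneg_orthant" and R: "\<And>X. X \<in> symmetric_matrices \<Longrightarrow> R X = \<rho> (eigenvalues X)"
    and X: "X \<in> low_rank_dom symmetric_matrices R r"
  obtains W g where "is_eigendecomposition X W g" "g \<in> nonneg_orthant" "R X = \<rho> g"
    "\<And>k. r \<le> position k \<Longrightarrow> g $ k = 0"
proof -
  have sym: "X \<in> symmetric_matrices" and fin: "R X < \<infinity>" and rank: "rank X \<le> r"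
    using X by (auto simp: low_rank_dom_def dom_on_def)
  obtain W g where ed: "is_eigendecomposition X W g"
    using ex_eigendecomposition[of X] sym unfolding symmetric_matrices_def by blast
  have RX: "R X = \<rho> g" using R[OF sym] eigenvalues_if_eigendecomposition[OF ed] by simp
  then have g: "g \<in> nonneg_orthant" using fin dom by (auto simp: dom_on_def)
  from that[OF ed g RX] show thesis
    using svd_entry_eq_0[OF is_svd_if_eigenvalues_nonneg[OF ed g]] rank by force
qed

lemma low_rank_matrix_minimizes_symmetric:
  fixes R :: "real ^ 'd::{finite,linorder} ^ 'd::{finite,linorder} \<Rightarrow> ereal" and u :: "real ^ 'r::{finite,linorder}"
  assumes r: "CARD('r) \<le> CARD('d)"
    and perm: "permutation_invariant UNIV \<rho>" and dom: "dom_on UNIV \<rho> \<subseteq> nonneg_orthant"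
    and R: "\<And>X. X \<in> symmetric_matrices \<Longrightarrow> R X = \<rho> (eigenvalues X)"
    and lam: "0 < lam" and Y: "is_eigendecomposition Y U s" and u: "u \<in> reduced_minimizers \<rho> lam s"
  shows "low_rank_matrix U u U
    \<in> argmin_set (low_rank_dom symmetric_matrices R CARD('r)) (prox_objective R lam Y)"
proof -
  let ?Z = "low_rank_matrix U u U"
  note U = is_eigendecomposition_orthogonal(1)[OF Y] and D = reduced_minimizersD[OF u]
  have sym: "?Z \<in> symmetric_matrices"
    unfolding symmetric_matrices_def low_rank_matrix_eq[OF r] mem_Collect_eq
    by (simp add: vec_eq_iff svd_entry transpose_def[of "_ ** _"] mult_ac)
  have RZ: "R ?Z = \<rho> (pad_zeros u)"
    using permutation_invariant_eigenvalues_low_rank[OF r perm U] R[OF sym] by simp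
  have le: "prox_objective R lam Y ?Z \<le> prox_objective R lam Y X"
    if X: "X \<in> low_rank_dom symmetric_matrices R CARD('r)" for X
  proof -
    obtain W g where ed: "is_eigendecomposition X W g" and g: "g \<in> nonneg_orthant" and RX: "R X = \<rho> g"
      and g0: "\<And>k. CARD('r) \<le> position k \<Longrightarrow> g $ k = 0"
      using ex_nonneg_eigendecomposition_low_rank[OF dom R X] by blast
    have "norm X = norm g"
      using is_svd_if_eigenvalues_nonneg[OF ed g] norm_svd[of W W g] by (simp add: is_svd_def)
    moreover have "?Z \<bullet> Y = pad_zeros u \<bullet> s"
      using Y inner_svd_same[OF U U, of "pad_zeros u" s] by (simp add: low_rank_matrix_eq[OF r] is_eigendecomposition_def)
    ultimately show ?thesis
      unfolding prox_objective_def RZ RX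
      using trace_inequality_symmetric[OF ed g Y] g g0 norm_svd[OF U U, of "pad_zeros u"]
      by (intro reduced_minimizer_prox_le[OF r lam u]) (simp_all add: low_rank_matrix_eq[OF r])
  qed
  have "?Z \<in> low_rank_dom symmetric_matrices R CARD('r)"
    using D(2) RZ sym by (simp add: low_rank_dom_def dom_on_def rank_low_rank_matrix)
  then show ?thesis
    using le D(2) RZ by (auto simp: argmin_set_def is_arg_min_def not_less prox_objective_def)
qed

lemma reduced_minimizers_nonempty_symmetric:
  fixes R :: "real ^ 'd::{finite,linorder} ^ 'd::{finite,linorder} \<Rightarrow> ereal"
  assumes r: "CARD('r::{finite,linorder}) \<le> CARD('d)"
    and \<rho>: "proper_fun UNIV \<rho>" "closed_convex_fun UNIV \<rho>" and dom: "dom_on UNIV \<rho> \<subseteq> nonneg_orthant"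
    and R: "\<And>X. X \<in> symmetric_matrices \<Longrightarrow> R X = \<rho> (eigenvalues X)"
    and X: "X \<in> low_rank_dom symmetric_matrices R CARD('r)" and lam: "0 < lam"
  shows "(reduced_minimizers \<rho> lam s :: (real ^ 'r::{finite,linorder}) set) \<noteq> {}"
proof -
  obtain W g where "g \<in> nonneg_orthant" "R X = \<rho> g" "\<And>k. CARD('r) \<le> position k \<Longrightarrow> g $ k = 0"
    using ex_nonneg_eigendecomposition_low_rank[OF dom R X] by blast
  then show ?thesis
    using X \<rho>(1)
    by (intro reduced_minimizers_nonempty[OF r \<rho>(2) _ subset_UNIV _ _ _ lam])
      (auto simp: proper_fun_def low_rank_dom_def dom_on_def)
qed

theorem lemma2:
  shows
    "(\<forall>(f :: real ^ 'd2 ^ 'd1 \<Rightarrow> real) (R :: real ^ 'd2 ^ 'd1 \<Rightarrow> ereal)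
       (\<rho> :: real ^ 'q::{finite,linorder} \<Rightarrow> ereal).
        CARD('q::{finite,linorder}) = min CARD('d1) CARD('d2) \<and>
        CARD('r::{finite,linorder}) \<le> CARD('q::{finite,linorder}) \<and>
        composite_problem UNIV f R \<and>
        proper_fun nonneg_orthant \<rho> \<and> closed_convex_fun nonneg_orthant \<rho> \<and>
        permutation_invariant nonneg_orthant \<rho> \<and>
        (\<forall>X. R X = \<rho> (singular_values X))
      \<longrightarrow>
        (\<forall>Y lam U \<sigma> V (u :: real ^ 'r::{finite,linorder}).
           0 < lam \<and> is_svd Y U \<sigma> V \<and> u \<in> reduced_minimizers \<rho> lam \<sigma> \<longrightarrow>
           low_rank_matrix U u V
             \<in> argmin_set (low_rank_dom UNIV R CARD('r::{finite,linorder}))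
                 (prox_objective R lam Y)) \<and>
        ((\<forall>Xs\<in>solutions UNIV f R. rank Xs \<le> CARD('r::{finite,linorder})) \<longrightarrow>
           (\<forall>(Y :: real ^ 'd2 ^ 'd1) lam. 0 < lam \<longrightarrow>
              (\<exists>U \<sigma> V. is_svd Y U \<sigma> V \<and>
                 (reduced_minimizers \<rho> lam \<sigma> :: (real ^ 'r::{finite,linorder}) set) \<noteq> {})) \<and>
           (\<forall>A. (\<forall>Y. A Y 0 \<in> dom_on UNIV R) \<and>
                (\<forall>Y lam. 0 < lam \<longrightarrow>
                   (\<exists>U \<sigma> V (u :: real ^ 'r::{finite,linorder}).
                      is_svd Y U \<sigma> V \<and> u \<in> reduced_minimizers \<rho> lam \<sigma> \<and>
                      A Y lam = low_rank_matrix U u V))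
              \<longrightarrow> weak_prox_oracle UNIV f R A)))
     \<and>
     (\<forall>(f :: real ^ 'd::{finite,linorder} ^ 'd::{finite,linorder} \<Rightarrow> real)
       (R :: real ^ 'd::{finite,linorder} ^ 'd::{finite,linorder} \<Rightarrow> ereal)
       (\<rho> :: real ^ 'd::{finite,linorder} \<Rightarrow> ereal).
        CARD('k::{finite,linorder}) \<le> CARD('d::{finite,linorder}) \<and>
        composite_problem symmetric_matrices f R \<and>
        proper_fun UNIV \<rho> \<and> closed_convex_fun UNIV \<rho> \<and>
        permutation_invariant UNIV \<rho> \<and> dom_on UNIV \<rho> \<subseteq> nonneg_orthant \<and>
        (\<forall>X\<in>symmetric_matrices. R X = \<rho> (eigenvalues X))
      \<longrightarrow>
        (\<forall>Y\<in>symmetric_matrices. \<forall>lam U \<gamma> (u :: real ^ 'k::{finite,linorder}).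
           0 < lam \<and> is_eigendecomposition Y U \<gamma> \<and> u \<in> reduced_minimizers \<rho> lam \<gamma> \<longrightarrow>
           low_rank_matrix U u U
             \<in> argmin_set (low_rank_dom symmetric_matrices R CARD('k::{finite,linorder}))
                 (prox_objective R lam Y)) \<and>
        ((\<forall>Xs\<in>solutions symmetric_matrices f R. rank Xs \<le> CARD('k::{finite,linorder})) \<longrightarrow>
           (\<forall>Y\<in>symmetric_matrices. \<forall>lam. 0 < lam \<longrightarrow>
              (\<exists>U \<gamma>. is_eigendecomposition Y U \<gamma> \<and>
                 (reduced_minimizers \<rho> lam \<gamma> :: (real ^ 'k::{finite,linorder}) set) \<noteq> {})) \<and>
           (\<forall>A. (\<forall>Y\<in>symmetric_matrices. A Y 0 \<in> dom_on symmetric_matrices R) \<and>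
                (\<forall>Y\<in>symmetric_matrices. \<forall>lam. 0 < lam \<longrightarrow>
                   (\<exists>U \<gamma> (u :: real ^ 'k::{finite,linorder}).
                      is_eigendecomposition Y U \<gamma> \<and> u \<in> reduced_minimizers \<rho> lam \<gamma> \<and>
                      A Y lam = low_rank_matrix U u U))
              \<longrightarrow> weak_prox_oracle symmetric_matrices f R A)))"
proof (intro conjI allI impI, goal_cases)
  case (1 f R \<rho> Y lam U \<sigma> V u)
  then show ?case by (intro low_rank_matrix_minimizes_rectangular[of \<rho>]) auto
next
  case (2 f R \<rho> Y lam)
  obtain U \<sigma> V where svd: "is_svd Y U (\<sigma> :: real ^ 'q::{finite,linorder}) V"
    using ex_svd[of Y] 2 by blast
  obtain X where "X \<in> low_rank_dom UNIV R CARD('r::{finite,linorder})"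
    using ex_solution_low_rank 2 by blast
  then have "(reduced_minimizers \<rho> lam \<sigma> :: (real ^ 'r::{finite,linorder}) set) \<noteq> {}"
    using 2 by (intro reduced_minimizers_nonempty_rectangular[where R = R]) auto
  then show ?case using svd by blast
next
  case (3 f R \<rho> A)
  show ?case
  proof (rule weak_prox_oracleI)
    fix Y lam assume "0 < (lam :: real)"
    then obtain U \<sigma> V and u :: "real ^ 'r::{finite,linorder}" where
      "is_svd Y U \<sigma> V" "u \<in> reduced_minimizers \<rho> lam \<sigma>" "A Y lam = low_rank_matrix U u V"
      using 3 by blast
    then show "A Y lam \<in> argmin_set (low_rank_dom UNIV R CARD('r::{finite,linorder})) (prox_objective R lam Y)"
      using 3 \<open>0 < lam\<close> by (auto intro!: low_rank_matrix_minimizes_rectangular[of \<rho>])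
  qed (use 3 in blast)+
next
  case (4 f R \<rho>)
  show ?case
  proof (intro ballI allI impI)
    fix Y lam U \<gamma> and u :: "real ^ 'k::{finite,linorder}"
    assume "0 < lam \<and> is_eigendecomposition Y U \<gamma> \<and> u \<in> reduced_minimizers \<rho> lam \<gamma>"
    then show "low_rank_matrix U u U
      \<in> argmin_set (low_rank_dom symmetric_matrices R CARD('k::{finite,linorder})) (prox_objective R lam Y)"
      using 4 by (intro low_rank_matrix_minimizes_symmetric[of \<rho>]) auto
  qed
next
  case (5 f R \<rho>)
  show ?case
  proof (intro ballI allI impI)
    fix Y :: "real ^ 'd::{finite,linorder} ^ 'd::{finite,linorder}" and lam :: real
    assume Y: "Y \<in> symmetric_matrices" and lam: "0 < lam"
    obtain U \<gamma> where ed: "is_eigendecomposition Y U \<gamma>"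
      using ex_eigendecomposition[of Y] Y unfolding symmetric_matrices_def by blast
    obtain X where "X \<in> low_rank_dom symmetric_matrices R CARD('k::{finite,linorder})"
      using ex_solution_low_rank 5 by blast
    then have "(reduced_minimizers \<rho> lam \<gamma> :: (real ^ 'k::{finite,linorder}) set) \<noteq> {}"
      using 5 lam by (intro reduced_minimizers_nonempty_symmetric[where R = R]) auto
    then show "\<exists>U \<gamma>. is_eigendecomposition Y U \<gamma> \<and>
        (reduced_minimizers \<rho> lam \<gamma> :: (real ^ 'k::{finite,linorder}) set) \<noteq> {}"
      using ed by blast
  qed
next
  case (6 f R \<rho> A)
  show ?case
  proof (rule weak_prox_oracleI)
    fix Y :: "real ^ 'd::{finite,linorder} ^ 'd::{finite,linorder}" and lam :: real
    assume Y: "Y \<in> symmetric_matrices" and lam: "0 < lam"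
    then obtain U \<gamma> and u :: "real ^ 'k::{finite,linorder}" where
      "is_eigendecomposition Y U \<gamma>" "u \<in> reduced_minimizers \<rho> lam \<gamma>" "A Y lam = low_rank_matrix U u U"
      using 6 by blast
    then show "A Y lam \<in> argmin_set (low_rank_dom symmetric_matrices R CARD('k::{finite,linorder})) (prox_objective R lam Y)"
      using 6 lam by (auto intro!: low_rank_matrix_minimizes_symmetric[of \<rho>])
  qed (use 6 in blast)+
qed

end
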